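(* Let $(\mathfrak g,[\cdot,\cdot])$ be a finite-dimensional real Lie algebra, $\mathfrak i\lhd\mathfrak g$ a Lie ideal, and $\sigma\colon\mathfrak g/\mathfrak i\to\mathfrak g$ a linear splitting of the short exact sequence of vector spaces $0\to\mathfrak i\to\mathfrak g\to\mathfrak g/\mathfrak i\to0$. There is a bijection between (1) Maurer–Cartan elements of the $L_\infty[1]$-algebra $\big(C^\bullet(\mathfrak g;\mathfrak i^*\otimes\mathfrak g/\mathfrak i),\ m_1=\delta^{\mathrm{Hom}}_{\mathfrak g\rhd\mathfrak i},\ m_2^\sigma\big)$, and (2) small deformations of the ideal $\mathfrak i\lhd\mathfrak g$, given by the correspondence $C^0(\mathfrak g;\mathfrak i^*\otimes\mathfrak g/\mathfrak i)\ni\phi\mapsto\mathrm{graph}(\sigma\circ\phi)=\{u+\sigma(\phi(u))\mid u\in\mathfrak i\}\subseteq\mathfrak g$.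
   Context: $\pi_{\mathfrak g/\mathfrak i}\colon\mathfrak g\to\mathfrak g/\mathfrak i$, $x\mapsto\bar x$, is the projection and $\mathrm{pr}_\sigma\colon\mathfrak g\to\mathfrak i$, $\mathrm{pr}_\sigma(x)=x-\sigma(\bar x)$. A small deformation of $\mathfrak i\lhd\mathfrak g$ (relative to the complement $\sigma(\mathfrak g/\mathfrak i)$) is a subspace $\mathfrak i'\subset\mathfrak g$ with $\dim\mathfrak i'=\dim\mathfrak i$, $\mathfrak g=\mathfrak i'\oplus\sigma(\mathfrak g/\mathfrak i)$ and $\mathfrak i'$ an ideal in $\mathfrak g$. $C^k(\mathfrak g;\mathfrak i^*\otimes\mathfrak g/\mathfrak i)=\wedge^k\mathfrak g^*\otimes\mathfrak i^*\otimes\mathfrak g/\mathfrak i$ (in degree $k$), and $\delta^{\mathrm{Hom}}_{\mathfrak g\rhd\mathfrak i}$ is the Chevalley–Eilenberg differential of the representation $\mathrm{ad}^{\mathrm{Hom}}_x(\phi)(u)=[\bar x,\phi(u)]-\phi([x,u])$ of $\mathfrak g$ on $\mathrm{Hom}(\mathfrak i,\mathfrak g/\mathfrak i)$; in particular for $\phi\in C^0$, $\delta^{\mathrm{Hom}}_{\mathfrak g\rhd\mathfrak i}(\phi)(x,u)=[\bar x,\phi(u)]-\phi([x,u])$. The binary bracket $m_2^\sigma$ is, for $\psi\in C^k$, $\phi\in C^l$, $x_j\in\mathfrak g$, $u\in\mathfrak i$, $$m_2^\sigma(\psi,\phi)(x_1,\dots,x_{k+l+1},u)=-(-1)^k\!\!\sum_{\tau\in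 S_{(k,1,l)}}\!\!(-1)^\tau\phi\big(x_{\tau(k+2)},\dots,x_{\tau(k+l+1)},\mathrm{pr}_\sigma[x_{\tau(k+1)},\sigma(\psi(x_{\tau(1)},\dots,x_{\tau(k)},u))]\big)$$ $$-(-1)^{(k+1)l}\!\!\sum_{\tau\in S_{(l,1,k)}}\!\!(-1)^\tau\psi\big(x_{\tau(l+2)},\dots,x_{\tau(k+l+1)},\mathrm{pr}_\sigma[x_{\tau(l+1)},\sigma(\phi(x_{\tau(1)},\dots,x_{\tau(l)},u))]\big),$$ where $S_{(a,b,c)}$ is the set of permutations $\tau\in S_{a+b+c}$ increasing on each of the three consecutive blocks of lengths $a,b,c$. For $\phi\in C^0$ this gives $m_2^\sigma(\phi,\phi)(x,u)=-2\phi(\mathrm{pr}_\sigma[x,\sigma(\phi(u))])$. All higher brackets are zero. (An $L_\infty[1]$-algebra structure on a graded vector space consists of graded symmetric degree-$1$ multibrackets satisfying the higher Jacobi identities.) A Maurer–Cartan element is a degree-$0$ element $\phi$ with $m_1(\phi)+\tfrac12m_2^\sigma(\phi,\phi)=0$. *)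

theory Defs
  imports Complex_Main "HOL-Library.Function_Algebras" "HOL-Combinatorics.Permutations"
begin

section \<open>Pointwise vector space structure on functions\<close>

instantiation "fun" :: (type, real_vector) real_vector
begin

definition scaleR_fun :: "real \<Rightarrow> ('a \<Rightarrow> 'b) \<Rightarrow> 'a \<Rightarrow> 'b" where
  "scaleR_fun c f = (\<lambda>x. c *\<^sub>R f x)"

instance
  by standard (simp_all add: scaleR_fun_def fun_eq_iff scaleR_add_right scaleR_add_left)

end


section \<open>Lie algebras, ideals and quotients\<close>

definition lie_algebra :: "('g::real_vector \<Rightarrow> 'g \<Rightarrow> 'g) \<Rightarrow> bool" where
  "lie_algebra br \<longleftrightarrow>
     (\<forall>x. linear (br x)) \<and> (\<forall>y. linear (\<lambda>x. br x y)) \<and>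
     (\<forall>x. br x x = 0) \<and>
     (\<forall>x y z. br x (br y z) + br y (br z x) + br z (br x y) = 0)"

definition lie_ideal :: "('g::real_vector \<Rightarrow> 'g \<Rightarrow> 'g) \<Rightarrow> 'g set \<Rightarrow> bool" where
  "lie_ideal br I \<longleftrightarrow> subspace I \<and> (\<forall>x. \<forall>u\<in>I. br x u \<in> I)"

text \<open>
  The quotient of \<open>'g\<close> by \<open>I\<close> is presented, as in the short exact sequence, by a linear
  surjection \<open>\<pi>\<close> onto a vector space \<open>'q\<close> with kernel \<open>I\<close>. The elements of \<open>'q\<close> then
  correspond to the cosets of \<open>I\<close>, see \<open>quotient_map_cosets\<close>.
\<close>

definition quotient_map :: "'g::real_vector set \<Rightarrow> ('g \<Rightarrow> 'q::real_vector) \<Rightarrow> bool" where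
  "quotient_map I \<pi> \<longleftrightarrow> linear \<pi> \<and> surj \<pi> \<and> {x. \<pi> x = 0} = I"

lemma quotient_map_cosets:
  assumes "quotient_map I \<pi>"
  shows "bij_betw (\<lambda>q. \<pi> -` {q}) UNIV (range (\<lambda>x. (+) x ` I))"
    and "\<pi> -` {\<pi> x} = (+) x ` I"
proof -
  have lin: "linear \<pi>" and sur: "surj \<pi>" and ker: "I = {x. \<pi> x = 0}"
    using assms by (auto simp: quotient_map_def)
  show fib: "\<pi> -` {\<pi> x} = (+) x ` I" for x
  proof (intro set_eqI iffI)
    fix y assume "y \<in> \<pi> -` {\<pi> x}"
    then have "y - x \<in> I" by (simp add: ker linear_diff[OF lin])
    then show "y \<in> (+) x ` I" by (intro image_eqI[of _ _ "y - x"]) simp_all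
  next
    fix y assume "y \<in> (+) x ` I"
    then show "y \<in> \<pi> -` {\<pi> x}" by (auto simp: ker linear_add[OF lin])
  qed
  have "inj (\<lambda>q. \<pi> -` {q})"
  proof (rule injI)
    fix p q assume "\<pi> -` {p} = \<pi> -` {q}"
    moreover obtain x where "\<pi> x = p" using sur by (metis surjD)
    ultimately show "p = q" by blast
  qed
  moreover have "range (\<lambda>q. \<pi> -` {q}) = range (\<lambda>x. \<pi> -` {\<pi> x})"
    using sur by (auto simp: image_iff) (metis surjD)
  ultimately show "bij_betw (\<lambda>q. \<pi> -` {q}) UNIV (range (\<lambda>x. (+) x ` I))"
    by (simp add: bij_betw_def fib)
qed

text \<open>Bracket of representatives; for an ideal \<open>I\<close> it does not depend on their choice.\<close>

definition quot_bracket ::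
    "('g \<Rightarrow> 'g \<Rightarrow> 'g) \<Rightarrow> ('g \<Rightarrow> 'q) \<Rightarrow> 'q \<Rightarrow> 'q \<Rightarrow> 'q" where
  "quot_bracket br \<pi> a b = \<pi> (br (inv \<pi> a) (inv \<pi> b))"

lemma quot_bracket:
  assumes "lie_algebra br" "lie_ideal br I" "quotient_map I \<pi>"
  shows "quot_bracket br \<pi> (\<pi> x) (\<pi> y) = \<pi> (br x y)"
proof -
  have lin: "linear \<pi>" and sur: "surj \<pi>" and ker: "I = {x. \<pi> x = 0}"
    using assms by (auto simp: quotient_map_def)
  have br1: "linear (br z)" and br2: "linear (\<lambda>z. br z w)" for z w
    using assms(1) by (auto simp: lie_algebra_def)
  have idl: "br z u \<in> I" if "u \<in> I" for z u using that assms(2) by (auto simp: lie_ideal_def)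
  have skew: "br z w = - br w z" for z w
  proof -
    have "br (z + w) (z + w) = br z z + br z w + (br w z + br w w)"
      by (simp add: linear_add[OF br1] linear_add[OF br2])
    moreover have "br v v = 0" for v using assms(1) by (auto simp: lie_algebra_def)
    ultimately show ?thesis by (simp add: eq_neg_iff_add_eq_0)
  qed
  have 1: "\<pi> (br z u) = 0" if "\<pi> u = 0" for z u using idl[of u z] that ker by auto
  have 2: "\<pi> (br u z) = 0" if "\<pi> u = 0" for z u
    using 1[OF that, of z] by (metis skew linear_neg[OF lin] neg_equal_0_iff_equal)
  define x' where "x' = inv \<pi> (\<pi> x)"
  define y' where "y' = inv \<pi> (\<pi> y)"
  have "\<pi> (x' - x) = 0" "\<pi> (y' - y) = 0"
    unfolding x'_def y'_def by (simp_all add: linear_diff[OF lin] surj_f_inv_f[OF sur])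
  then have "\<pi> (br x' (y' - y)) = 0" "\<pi> (br (x' - x) y) = 0" using 1 2 by blast+
  then show ?thesis
    by (simp add: quot_bracket_def linear_diff[OF br1] linear_diff[OF br2] linear_diff[OF lin]
        flip: x'_def y'_def)
qed

definition small_deformation ::
    "('g::real_vector \<Rightarrow> 'g \<Rightarrow> 'g) \<Rightarrow> 'g set \<Rightarrow> ('q::real_vector \<Rightarrow> 'g) \<Rightarrow> 'g set \<Rightarrow> bool" where
  "small_deformation br I \<sigma> J \<longleftrightarrow>
     subspace J \<and> dim J = dim I \<and>
     J \<inter> range \<sigma> = {0} \<and> (\<forall>x. \<exists>v\<in>J. \<exists>w\<in>range \<sigma>. x = v + w) \<and>
     lie_ideal br J"


section \<open>\<open>L\<^sub>\<infinity>[1]\<close>-algebras\<close>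

text \<open>
  \<open>block_perms [a, b, c]\<close> is $S_{(a,b,c)}$: the permutations of \<open>{0..<a+b+c}\<close> that are
  increasing on each of the consecutive blocks of lengths \<open>a\<close>, \<open>b\<close>, \<open>c\<close>.
\<close>

definition block_perms :: "nat list \<Rightarrow> (nat \<Rightarrow> nat) set" where
  "block_perms bs = {\<tau>. \<tau> permutes {..<sum_list bs} \<and>
     (\<forall>r<length bs. strict_mono_on {sum_list (take r bs)..<sum_list (take (Suc r) bs)} \<tau>)}"

definition perm_list :: "(nat \<Rightarrow> nat) \<Rightarrow> 'a list \<Rightarrow> 'a list" where
  "perm_list \<tau> xs = map (\<lambda>j. xs ! \<tau> j) [0..<length xs]"

text \<open>
  Koszul sign of the rearrangement \<open>perm_list \<tau>\<close> of homogeneous elements of degrees \<open>ds\<close>: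
  one factor $(-1)^{|a||b|}$ for each pair \<open>a\<close>, \<open>b\<close> whose order is reversed.
\<close>

definition koszul_sign :: "(nat \<Rightarrow> nat) \<Rightarrow> nat list \<Rightarrow> real" where
  "koszul_sign \<tau> ds =
     (\<Prod>(i, j)\<in>{(i, j). i < j \<and> j < length ds \<and> \<tau> j < \<tau> i}. (-1) ^ (ds ! \<tau> i * ds ! \<tau> j))"

text \<open>
  A (nonnegatively) graded vector space is a family \<open>V\<close> of subspaces of an ambient vector space.
  The multibrackets of all arities are one function on lists of homogeneous elements, each
  tagged with its degree.
\<close>

definition homogeneous :: "(nat \<Rightarrow> 'v set) \<Rightarrow> (nat \<times> 'v) list \<Rightarrow> bool" where
  "homogeneous V xs \<longleftrightarrow> (\<forall>(d, v)\<in>set xs. v \<in> V d)"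

definition total_degree :: "(nat \<times> 'v) list \<Rightarrow> nat" where
  "total_degree xs = sum_list (map fst xs)"

definition Linfty1_algebra ::
    "(nat \<Rightarrow> 'v::real_vector set) \<Rightarrow> ((nat \<times> 'v) list \<Rightarrow> 'v) \<Rightarrow> bool" where
  "Linfty1_algebra V m \<longleftrightarrow>
     (\<forall>d. subspace (V d)) \<and>
     \<comment> \<open>multilinear of degree \<open>1\<close>\<close>
     (\<forall>xs. xs \<noteq> [] \<and> homogeneous V xs \<longrightarrow> m xs \<in> V (Suc (total_degree xs))) \<and>
     (\<forall>xs i d a b c. homogeneous V xs \<and> i < length xs \<and> d = fst (xs ! i) \<and> a \<in> V d \<and> b \<in> V d \<longrightarrow>
        m (xs[i := (d, c *\<^sub>R a + b)]) = c *\<^sub>R m (xs[i := (d, a)]) + m (xs[i := (d, b)])) \<and>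
     \<comment> \<open>graded symmetric\<close>
     (\<forall>xs \<tau>. xs \<noteq> [] \<and> homogeneous V xs \<and> \<tau> permutes {..<length xs} \<longrightarrow>
        m xs = koszul_sign \<tau> (map fst xs) *\<^sub>R m (perm_list \<tau> xs)) \<and>
     \<comment> \<open>higher Jacobi identities\<close>
     (\<forall>xs. xs \<noteq> [] \<and> homogeneous V xs \<longrightarrow>
        (\<Sum>i=1..length xs. \<Sum>\<tau>\<in>block_perms [i, length xs - i].
           koszul_sign \<tau> (map fst xs) *\<^sub>R
           (let ys = perm_list \<tau> xs; inner = take i ys
            in m ((Suc (total_degree inner), m inner) # drop i ys))) = 0)"

text \<open>Maurer--Cartan elements when all brackets of arity greater than two vanish.\<close>

definition MC_elements :: "(nat \<Rightarrow> 'v::real_vector set) \<Rightarrow> ((nat \<times> 'v) list \<Rightarrow> 'v) \<Rightarrow> 'v set" where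
  "MC_elements V m = {\<phi> \<in> V 0. m [(0, \<phi>)] + (1 / 2) *\<^sub>R m [(0, \<phi>), (0, \<phi>)] = 0}"


section \<open>The complex \<open>C\<^sup>\<bullet>(\<gg>; \<ii>\<^sup>* \<otimes> \<gg>/\<ii>)\<close> and its brackets\<close>

text \<open>
  A \<open>k\<close>-cochain maps a list \<open>[x\<^sub>1, \<dots>, x\<^sub>k]\<close> and \<open>u \<in> I\<close> to \<open>'q\<close>, alternating and
  multilinear in the list and linear in \<open>u\<close>. It is extended by \<open>0\<close> to lists of other lengths and
  to \<open>u \<notin> I\<close>, so that cochains that agree on their proper arguments are equal.
\<close>

definition cochains ::
    "'g::real_vector set \<Rightarrow> nat \<Rightarrow> ('g list \<Rightarrow> 'g \<Rightarrow> 'q::real_vector) set" where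
  "cochains I k = {\<omega>.
     (\<forall>xs u. length xs \<noteq> k \<or> u \<notin> I \<longrightarrow> \<omega> xs u = 0) \<and>
     (\<forall>xs i u. length xs = k \<and> i < k \<longrightarrow> linear (\<lambda>x. \<omega> (xs[i := x]) u)) \<and>
     (\<forall>xs i j u. length xs = k \<and> i < j \<and> j < k \<and> xs ! i = xs ! j \<longrightarrow> \<omega> xs u = 0) \<and>
     (\<forall>xs. \<forall>u\<in>I. \<forall>v\<in>I. \<forall>a b. \<omega> xs (a *\<^sub>R u + b *\<^sub>R v) = a *\<^sub>R \<omega> xs u + b *\<^sub>R \<omega> xs v)}"

definition ad_Hom ::
    "('g::real_vector \<Rightarrow> 'g \<Rightarrow> 'g) \<Rightarrow> 'g set \<Rightarrow> ('g \<Rightarrow> 'q::real_vector) \<Rightarrow> 'g \<Rightarrow> ('g \<Rightarrow> 'q) \<Rightarrow> 'g \<Rightarrow> 'q" where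
  "ad_Hom br I \<pi> x \<phi> u =
     (if u \<in> I then quot_bracket br \<pi> (\<pi> x) (\<phi> u) - \<phi> (br x u) else 0)"

text \<open>
  Chevalley--Eilenberg differential of \<open>ad_Hom\<close> on \<open>k\<close>-cochains; arguments are numbered from
  \<open>0\<close>, and \<open>nths xs (- A)\<close> omits those with index in \<open>A\<close>.
\<close>

definition delta_Hom ::
    "('g::real_vector \<Rightarrow> 'g \<Rightarrow> 'g) \<Rightarrow> 'g set \<Rightarrow> ('g \<Rightarrow> 'q::real_vector) \<Rightarrow> nat \<Rightarrow>
     ('g list \<Rightarrow> 'g \<Rightarrow> 'q) \<Rightarrow> 'g list \<Rightarrow> 'g \<Rightarrow> 'q" where
  "delta_Hom br I \<pi> k \<omega> xs u =
     (if length xs = k + 1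
      then (\<Sum>i<k + 1. (-1) ^ i *\<^sub>R ad_Hom br I \<pi> (xs ! i) (\<omega> (nths xs (- {i}))) u)
         + (\<Sum>j<k + 1. \<Sum>i<j. (-1) ^ (i + j) *\<^sub>R \<omega> (br (xs ! i) (xs ! j) # nths xs (- {i, j})) u)
      else 0)"

definition pr :: "('g::real_vector \<Rightarrow> 'q) \<Rightarrow> ('q \<Rightarrow> 'g) \<Rightarrow> 'g \<Rightarrow> 'g" where
  "pr \<pi> \<sigma> x = x - \<sigma> (\<pi> x)"

text \<open>The sum over $S_{(k,1,l)}$ occurring in $m_2^\sigma(\psi,\phi)$.\<close>

definition shuffle_insert ::
    "('g::real_vector \<Rightarrow> 'g \<Rightarrow> 'g) \<Rightarrow> ('g \<Rightarrow> 'q::real_vector) \<Rightarrow> ('q \<Rightarrow> 'g) \<Rightarrow> nat \<Rightarrow> nat \<Rightarrow>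
     ('g list \<Rightarrow> 'g \<Rightarrow> 'q) \<Rightarrow> ('g list \<Rightarrow> 'g \<Rightarrow> 'q) \<Rightarrow> 'g list \<Rightarrow> 'g \<Rightarrow> 'q" where
  "shuffle_insert br \<pi> \<sigma> k l \<psi> \<phi> xs u =
     (\<Sum>\<tau>\<in>block_perms [k, 1, l]. of_int (sign \<tau>) *\<^sub>R
        (let ys = perm_list \<tau> xs
         in \<phi> (drop (k + 1) ys) (pr \<pi> \<sigma> (br (ys ! k) (\<sigma> (\<psi> (take k ys) u))))))"

definition m2 ::
    "('g::real_vector \<Rightarrow> 'g \<Rightarrow> 'g) \<Rightarrow> 'g set \<Rightarrow> ('g \<Rightarrow> 'q::real_vector) \<Rightarrow> ('q \<Rightarrow> 'g) \<Rightarrow> nat \<Rightarrow> nat \<Rightarrow>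
     ('g list \<Rightarrow> 'g \<Rightarrow> 'q) \<Rightarrow> ('g list \<Rightarrow> 'g \<Rightarrow> 'q) \<Rightarrow> 'g list \<Rightarrow> 'g \<Rightarrow> 'q" where
  "m2 br I \<pi> \<sigma> k l \<psi> \<phi> xs u =
     (if length xs = k + l + 1 \<and> u \<in> I
      then - ((-1) ^ k *\<^sub>R shuffle_insert br \<pi> \<sigma> k l \<psi> \<phi> xs u)
           - (-1) ^ ((k + 1) * l) *\<^sub>R shuffle_insert br \<pi> \<sigma> l k \<phi> \<psi> xs u
      else 0)"

fun ideal_brackets ::
    "('g::real_vector \<Rightarrow> 'g \<Rightarrow> 'g) \<Rightarrow> 'g set \<Rightarrow> ('g \<Rightarrow> 'q::real_vector) \<Rightarrow> ('q \<Rightarrow> 'g) \<Rightarrow>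
     (nat \<times> ('g list \<Rightarrow> 'g \<Rightarrow> 'q)) list \<Rightarrow> 'g list \<Rightarrow> 'g \<Rightarrow> 'q" where
  "ideal_brackets br I \<pi> \<sigma> [(k, \<omega>)] = delta_Hom br I \<pi> k \<omega>"
| "ideal_brackets br I \<pi> \<sigma> [(k, \<psi>), (l, \<phi>)] = m2 br I \<pi> \<sigma> k l \<psi> \<phi>"
| "ideal_brackets br I \<pi> \<sigma> _ = 0"

end

theory Submission
  imports Defs
begin

text \<open>
  Two things have to be shown: that the brackets satisfy the \<open>L\<^sub>\<infinity>[1]\<close> identities, and that the
  graph construction is a bijection. The second is elementary. A complement of \<open>range \<sigma>\<close> is the graph
  of a unique linear map \<open>\<phi>\<close> from \<open>I\<close> to the quotient, and the graph consists of those \<open>v\<close> with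
  \<open>\<pi> v = \<phi> (pr v)\<close>. Applying this criterion to \<open>br x (u + \<sigma> (\<phi> u))\<close> turns the condition that the
  graph is an ideal into the equation \<open>\<pi> [x, \<sigma> (\<phi> u)] = \<phi> ([x, u] + pr [x, \<sigma> (\<phi> u)])\<close>, which is the
  Maurer--Cartan equation evaluated at \<open>x\<close> and \<open>u\<close> (\<open>MC_iff_small_deformation\<close>).

  The identities are those of a derived bracket. Write endomorphisms of the Lie algebra as block
  matrices with respect to the decomposition into \<open>I\<close> and \<open>range \<sigma>\<close>. A cochain is a form with values
  in the corner of maps from \<open>I\<close> to \<open>range \<sigma>\<close>. The adjoint representation is block triangular: its
  diagonal part \<open>split_action\<close> is again a representation, since it is the direct sum of the actions
  on \<open>I\<close> and on the quotient, and its remaining corner is a one-form \<open>beta\<close> with values in the maps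
  from \<open>range \<sigma>\<close> to \<open>I\<close>. That the adjoint representation is a representation says in this corner that
  \<open>beta\<close> is closed. The unary bracket is the Chevalley--Eilenberg differential \<open>ce\<close> for the commutator
  action of \<open>split_action\<close>, and both sums in $m_2^\sigma$ are triple products of forms with \<open>beta\<close>
  in the middle. Hence everything follows from three facts about forms with values in an associative
  algebra: the differential squares to zero (\<open>ce_ce\<close>), it is a graded derivation of the product
  (\<open>ce_wedge\<close>), and the product is associative (\<open>wedge_assoc\<close>). With \<open>beta\<close> closed, the derivation
  rule gives the identity in two arguments (\<open>jacobi_2\<close>); associativity makes the terms of the
  identity in three arguments cancel in pairs (\<open>jacobi_3\<close>).

  To prove these facts without manipulating permutations, product and differential are defined by
  recursion on the list of arguments, through the rules by which they commute with insertion of a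
  first argument: the Leibniz rule for the product and Cartan's formula for the differential. All
  algebraic laws then follow by induction on the list. Permutations enter once, in the comparison
  with the sum over $S_{(k,1,l)}$: classifying such a permutation by the position of its first index
  reproduces the recursion (\<open>sum_block_perms_eq_wedge\<close>). Likewise, the explicit formula for the
  differential satisfies Cartan's formula on alternating forms (\<open>ce_explicit\<close>).
\<close>

section \<open>Forms with values in an algebra\<close>

definition contract :: "'g \<Rightarrow> ('g list \<Rightarrow> 'a) \<Rightarrow> 'g list \<Rightarrow> 'a" where
  "contract x w = (\<lambda>ys. w (x # ys))"

text \<open>
  Forms of all degrees are functions on lists of arbitrary length. The sign $(-1)^k$ attached to a
  form of degree \<open>k\<close> becomes an operator acting by the length of the list, so that the laws below
  need no degree assumptions.
\<close>

definition parity :: "('g list \<Rightarrow> 'a::real_vector) \<Rightarrow> 'g list \<Rightarrow> 'a" where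
  "parity w = (\<lambda>xs. (-1) ^ length xs *\<^sub>R w xs)"

text \<open>
  The shuffle product. The recursion says that contraction is a graded derivation of it. The values
  are multiplied in reverse order, because in the sums over $S_{(k,1,l)}$ the cochain evaluated on
  the first block is applied first.
\<close>

fun wedge :: "('g list \<Rightarrow> 'a::real_algebra) \<Rightarrow> ('g list \<Rightarrow> 'a) \<Rightarrow> 'g list \<Rightarrow> 'a" where
  "wedge a b [] = b [] * a []"
| "wedge a b (x # xs) = wedge (contract x a) b xs + wedge (parity a) (contract x b) xs"

definition of_degree :: "nat \<Rightarrow> ('g list \<Rightarrow> 'a::real_vector) \<Rightarrow> bool" where
  "of_degree k w \<longleftrightarrow> (\<forall>xs. length xs \<noteq> k \<longrightarrow> w xs = 0)"

definition multilinear :: "('g::real_vector list \<Rightarrow> 'a::real_vector) \<Rightarrow> bool" where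
  "multilinear w \<longleftrightarrow> (\<forall>xs ys. linear (\<lambda>x. w (xs @ x # ys)))"

text \<open>
  Repetition in adjacent places only: this form of the condition is inherited under recursion, and
  for multilinear forms it implies the vanishing on any repetition, see \<open>alternating_repeated\<close>.
\<close>

definition alternating :: "('g list \<Rightarrow> 'a::real_vector) \<Rightarrow> bool" where
  "alternating w \<longleftrightarrow> (\<forall>xs x ys. w (xs @ x # x # ys) = 0)"

lemma scaleR_fun_apply [simp]: "(c *\<^sub>R f) x = c *\<^sub>R f x"
  by (simp add: scaleR_fun_def)

lemma contract_simps [simp]:
  fixes v w :: "'g list \<Rightarrow> 'a::real_vector"
  shows "contract x (v + w) = contract x v + contract x w"
    "contract x (v - w) = contract x v - contract x w"
    "contract x (- w) = - contract x w"
    "contract x 0 = 0"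
    "contract x (c *\<^sub>R w) = c *\<^sub>R contract x w"
  by (simp_all add: contract_def fun_eq_iff)

lemma parity_simps [simp]:
  fixes v w :: "'g list \<Rightarrow> 'a::real_vector"
  shows "parity (v + w) = parity v + parity w"
    "parity (v - w) = parity v - parity w"
    "parity (- w) = - parity w"
    "parity 0 = 0"
    "parity (c *\<^sub>R w) = c *\<^sub>R parity w"
    "parity (parity w) = w"
    "parity w [] = w []"
  by (simp_all add: parity_def fun_eq_iff algebra_simps)

lemma contract_parity [simp]: "contract x (parity w) = - parity (contract x w)"
  by (simp add: contract_def parity_def fun_eq_iff)

lemma wedge_add_left: "wedge (a + a') b xs = wedge a b xs + wedge a' b xs"
  by (induction xs arbitrary: a a' b) (simp_all add: algebra_simps)

lemma wedge_add_right: "wedge a (b + b') xs = wedge a b xs + wedge a b' xs"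
  by (induction xs arbitrary: a b b') (simp_all add: algebra_simps)

lemma wedge_scaleR_left: "wedge (c *\<^sub>R a) b xs = c *\<^sub>R wedge a b xs"
  by (induction xs arbitrary: a b) (simp_all add: algebra_simps)

lemma wedge_scaleR_right: "wedge a (c *\<^sub>R b) xs = c *\<^sub>R wedge a b xs"
  by (induction xs arbitrary: a b) (simp_all add: algebra_simps)

lemma wedge_simps [simp]:
  "wedge (a + a') b = wedge a b + wedge a' b"
  "wedge a (b + b') = wedge a b + wedge a b'"
  "wedge (c *\<^sub>R a) b = c *\<^sub>R wedge a b"
  "wedge a (c *\<^sub>R b) = c *\<^sub>R wedge a b"
  "wedge (- a) b = - wedge a b"
  "wedge a (- b) = - wedge a b"
  "wedge (a - a') b = wedge a b - wedge a' b"
  "wedge a (b - b') = wedge a b - wedge a b'"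
  "wedge 0 b = 0"
  "wedge a 0 = 0"
proof -
  show 1: "wedge (a + a') b = wedge a b + wedge a' b" for a a' b :: "'a list \<Rightarrow> 'b"
    by (simp add: fun_eq_iff wedge_add_left)
  show 2: "wedge a (b + b') = wedge a b + wedge a b'" for a b b' :: "'a list \<Rightarrow> 'b"
    by (simp add: fun_eq_iff wedge_add_right)
  show 3: "wedge (c *\<^sub>R a) b = c *\<^sub>R wedge a b" for a b :: "'a list \<Rightarrow> 'b" and c
    by (simp add: fun_eq_iff wedge_scaleR_left)
  show 4: "wedge a (c *\<^sub>R b) = c *\<^sub>R wedge a b" for a b :: "'a list \<Rightarrow> 'b" and c
    by (simp add: fun_eq_iff wedge_scaleR_right)
  show 5: "wedge (- a) b = - wedge a b" "wedge a (- b) = - wedge a b" for a b :: "'a list \<Rightarrow> 'b"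
    using 3[of "-1" a b] 4[of a "-1" b] by simp_all
  show "wedge (a - a') b = wedge a b - wedge a' b" "wedge a (b - b') = wedge a b - wedge a b'"
    using 1[of a "- a'" b] 2[of a b "- b'"] by (simp_all add: 5)
  show "wedge 0 b = 0" "wedge a 0 = 0"
    using 3[of 0 0 b] 4[of a 0 0] by simp_all
qed

lemma contract_wedge [simp]: "contract x (wedge a b) = wedge (contract x a) b + wedge (parity a) (contract x b)"
  by (simp add: contract_def[of x "wedge a b"] fun_eq_iff)

lemma parity_Cons: "parity w (x # xs) = - parity (contract x w) xs"
  by (simp add: parity_def contract_def)

lemma parity_wedge_apply: "parity (wedge a b) xs = wedge (parity a) (parity b) xs"
  by (induction xs arbitrary: a b) (simp_all add: parity_Cons)

lemma parity_wedge [simp]: "parity (wedge a b) = wedge (parity a) (parity b)"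
  by (simp add: fun_eq_iff parity_wedge_apply)

text \<open>
  Both sides have the same value at the empty list, and contraction acts on both by the same
  Leibniz rule with three terms.
\<close>

lemma wedge_assoc: "wedge (wedge a b) c = wedge a (wedge b c)"
proof
  show "wedge (wedge a b) c xs = wedge a (wedge b c) xs" for xs
    by (induction xs arbitrary: a b c) (simp_all add: algebra_simps)
qed

lemma of_degree_contract: "of_degree (Suc k) w \<Longrightarrow> of_degree k (contract x w)"
  by (simp add: of_degree_def contract_def)

lemma of_degree_0_contract: "of_degree 0 w \<Longrightarrow> contract x w = 0"
  by (simp add: of_degree_def contract_def fun_eq_iff)

lemma parity_of_degree: "of_degree k w \<Longrightarrow> parity w = (-1) ^ k *\<^sub>R w"
  unfolding of_degree_def parity_def fun_eq_iff scaleR_fun_apply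
  by (metis scaleR_zero_right)

lemma of_degree_parity: "of_degree k w \<Longrightarrow> of_degree k (parity w)"
  by (simp add: of_degree_def parity_def)

lemma of_degree_simps [simp]: "of_degree k 0"
  "of_degree k v \<Longrightarrow> of_degree k w \<Longrightarrow> of_degree k (v + w)"
  "of_degree k v \<Longrightarrow> of_degree k w \<Longrightarrow> of_degree k (v - w)"
  "of_degree k w \<Longrightarrow> of_degree k (c *\<^sub>R w)"
  "of_degree k w \<Longrightarrow> of_degree k (- w)"
  by (auto simp: of_degree_def)

lemma of_degree_wedge_apply:
  "of_degree k a \<Longrightarrow> of_degree l b \<Longrightarrow> length xs \<noteq> k + l \<Longrightarrow> wedge a b xs = 0"
proof (induction xs arbitrary: a b k l)
  case Nil
  then show ?case by (auto simp: of_degree_def)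
next
  case (Cons x xs)
  have "wedge (contract x a) b xs = 0"
  proof (cases k)
    case 0
    then show ?thesis using Cons.prems by (simp add: of_degree_0_contract)
  next
    case (Suc k')
    with Cons.prems show ?thesis
      by (intro Cons.IH[of k' _ l] of_degree_contract) auto
  qed
  moreover have "wedge (parity a) (contract x b) xs = 0"
  proof (cases l)
    case 0
    then show ?thesis using Cons.prems by (simp add: of_degree_0_contract)
  next
    case (Suc l')
    with Cons.prems show ?thesis
      by (intro Cons.IH[of k _ l'] of_degree_contract of_degree_parity) auto
  qed
  ultimately show ?case by simp
qed

lemma of_degree_wedge: "of_degree k a \<Longrightarrow> of_degree l b \<Longrightarrow> of_degree (k + l) (wedge a b)"
  using of_degree_wedge_apply by (auto simp: of_degree_def[of "k + l"])

lemma multilinearD: "multilinear w \<Longrightarrow> linear (\<lambda>x. w (xs @ x # ys))"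
  by (simp add: multilinear_def)

lemma alternatingD: "alternating w \<Longrightarrow> w (xs @ x # x # ys) = 0"
  by (simp add: alternating_def)

lemma multilinear_contract: "multilinear w \<Longrightarrow> multilinear (contract x w)"
  using multilinearD[of w "x # _"] by (simp add: multilinear_def contract_def)

lemma multilinear_parity: "multilinear w \<Longrightarrow> multilinear (parity w)"
  using multilinearD[of w] by (simp add: multilinear_def parity_def linear_compose_scale_right linear_compose_neg)

lemma multilinear_simps [simp]: "multilinear 0"
  "multilinear v \<Longrightarrow> multilinear w \<Longrightarrow> multilinear (v + w)"
  "multilinear v \<Longrightarrow> multilinear w \<Longrightarrow> multilinear (v - w)"
  "multilinear w \<Longrightarrow> multilinear (c *\<^sub>R w)"
  "multilinear w \<Longrightarrow> multilinear (- w)"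
  by (auto simp: multilinear_def intro!: linear_compose_add linear_compose_sub linear_compose_neg
      linear_compose_scale_right linear_zero)

lemma alternating_simps [simp]: "alternating 0"
  "alternating v \<Longrightarrow> alternating w \<Longrightarrow> alternating (v + w)"
  "alternating v \<Longrightarrow> alternating w \<Longrightarrow> alternating (v - w)"
  "alternating w \<Longrightarrow> alternating (c *\<^sub>R w)"
  "alternating w \<Longrightarrow> alternating (- w)"
  by (auto simp: alternating_def)

lemma linear_contract: "multilinear w \<Longrightarrow> linear (\<lambda>x. contract x w)"
  using linear_add[OF multilinearD[of w "[]"]] linear_scale[OF multilinearD[of w "[]"]]
  by (auto intro!: linearI simp: contract_def fun_eq_iff)

lemma linear_wedge_left: "linear f \<Longrightarrow> linear (\<lambda>x. wedge (f x) b xs)"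
  by (rule linearI) (simp_all add: linear_add linear_scale)

lemma linear_wedge_right: "linear f \<Longrightarrow> linear (\<lambda>x. wedge a (f x) xs)"
  by (rule linearI) (simp_all add: linear_add linear_scale)

lemma multilinear_wedge:
  assumes "multilinear a" "multilinear b"
  shows "multilinear (wedge a b)"
proof -
  have "linear (\<lambda>x. wedge a b (xs @ x # ys))" for xs ys
    using assms
    by (induction xs arbitrary: a b)
       (auto intro!: linear_compose_add linear_wedge_left linear_wedge_right linear_contract
         multilinear_contract multilinear_parity)
  then show ?thesis by (simp add: multilinear_def)
qed

lemma alternating_contract: "alternating w \<Longrightarrow> alternating (contract x w)"
  using alternatingD[of w "x # _"] by (simp add: alternating_def contract_def)

lemma alternating_parity: "alternating w \<Longrightarrow> alternating (parity w)"
  by (simp add: alternating_def parity_def)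

lemma alternating_contract_contract: "alternating w \<Longrightarrow> contract x (contract x w) = 0"
  using alternatingD[of w "[]"] by (simp add: contract_def fun_eq_iff)

text \<open>
  Contracting twice with \<open>x\<close> kills each factor, and the two mixed terms cancel because \<open>parity\<close>
  anticommutes with contraction.
\<close>

lemma alternating_wedge:
  assumes "alternating a" "alternating b"
  shows "alternating (wedge a b)"
proof -
  have "wedge a b (xs @ x # x # ys) = 0" for xs x ys
    using assms
    by (induction xs arbitrary: a b)
       (simp_all add: alternating_contract_contract alternating_contract alternating_parity)
  then show ?thesis by (simp add: alternating_def)
qed

lemma alternating_swap:
  assumes "multilinear w" "alternating w"
  shows "w (xs @ y # x # ys) = - w (xs @ x # y # ys)"
proof -
  have 1: "linear (\<lambda>x. w (xs @ x # z # ys))" "linear (\<lambda>x. w (xs @ z # x # ys))" for z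
    using multilinearD[OF assms(1), of xs "z # ys"] multilinearD[OF assms(1), of "xs @ [z]" ys] by simp_all
  have 0: "w (xs @ z # z # ys) = 0" for z
    using assms(2) by (simp add: alternating_def)
  have "w (xs @ (x + y) # (x + y) # ys) = w (xs @ x # x # ys) + w (xs @ x # y # ys)
      + (w (xs @ y # x # ys) + w (xs @ y # y # ys))"
    by (simp only: linear_add[OF 1(1)] linear_add[OF 1(2)] add_ac)
  then show ?thesis by (simp add: 0 eq_neg_iff_add_eq_0 add.commute)
qed

lemma alternating_move:
  assumes "multilinear w" "alternating w"
  shows "w (zs @ y # xs @ ys) = (-1) ^ length xs *\<^sub>R w (zs @ xs @ y # ys)"
proof (induction xs arbitrary: zs)
  case (Cons x xs)
  have "w (zs @ y # (x # xs) @ ys) = - w ((zs @ [x]) @ y # xs @ ys)"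
    using alternating_swap[OF assms, of zs y x "xs @ ys"] by simp
  then show ?case by (simp only: Cons.IH) simp
qed simp

text \<open>
  Move the first of the two equal arguments next to the second.
\<close>

lemma alternating_repeated:
  assumes "multilinear w" "alternating w"
  shows "w (zs @ x # xs @ x # ys) = 0"
  using alternating_move[OF assms, of zs x xs "x # ys"] assms(2)[unfolded alternating_def, rule_format, of "zs @ xs" x ys]
  by simp

section \<open>The Chevalley--Eilenberg differential\<close>

locale lie_bracket =
  fixes br :: "'g::real_vector \<Rightarrow> 'g \<Rightarrow> 'g"
  assumes lie: "lie_algebra br"
begin

lemma linear_br: "linear (br x)" "linear (\<lambda>x. br x y)"
  and br_self [simp]: "br x x = 0"
  and jacobi: "br x (br y z) + br y (br z x) + br z (br x y) = 0"
  using lie by (auto simp: lie_algebra_def)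

lemma br_skew: "br x y = - br y x"
proof -
  have "br (x + y) (x + y) = br x x + br x y + (br y x + br y y)"
    by (simp only: linear_add[OF linear_br(1)] linear_add[OF linear_br(2)] add_ac)
  then show ?thesis by (simp add: eq_neg_iff_add_eq_0)
qed

lemma br_br: "br (br x y) z = br x (br y z) - br y (br x z)"
proof -
  have "br y (br z x) = - br y (br x z)" by (metis br_skew linear_neg[OF linear_br(1)])
  moreover have "br z (br x y) = - br (br x y) z" by (rule br_skew)
  ultimately show ?thesis using jacobi[of x y z] by (simp add: algebra_simps)
qed

end

locale lie_rep = lie_bracket br
  for br :: "'g::real_vector \<Rightarrow> 'g \<Rightarrow> 'g" +
  fixes D :: "'g \<Rightarrow> 'a::real_algebra"
  assumes linear_D: "linear D"
    and D_br: "D (br x y) = D x * D y - D y * D x"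
begin

text \<open>
  The Lie derivative and the differential for the commutator action \<open>a \<mapsto> D x * a - a * D x\<close> on
  the algebra of values. The second equation of \<open>ce\<close> is Cartan's formula.
\<close>

fun lie_der :: "'g \<Rightarrow> ('g list \<Rightarrow> 'a) \<Rightarrow> 'g list \<Rightarrow> 'a" where
  "lie_der x w [] = D x * w [] - w [] * D x"
| "lie_der x w (y # ys) = lie_der x (contract y w) ys - w (br x y # ys)"

fun ce :: "('g list \<Rightarrow> 'a) \<Rightarrow> 'g list \<Rightarrow> 'a" where
  "ce w [] = 0"
| "ce w (x # xs) = lie_der x w xs - ce (contract x w) xs"

lemma contract_lie_der [simp]: "contract y (lie_der x w) = lie_der x (contract y w) - contract (br x y) w"
  by (simp add: contract_def fun_eq_iff)

lemma contract_ce [simp]: "contract x (ce w) = lie_der x w - ce (contract x w)"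
  by (simp add: contract_def fun_eq_iff)

lemma lie_der_add_apply: "lie_der x (v + w) xs = lie_der x v xs + lie_der x w xs"
  by (induction xs arbitrary: v w) (simp_all add: algebra_simps)

lemma lie_der_scaleR_apply: "lie_der x (c *\<^sub>R w) xs = c *\<^sub>R lie_der x w xs"
  by (induction xs arbitrary: w) (simp_all add: algebra_simps)

lemma linear_lie_der: "linear (lie_der x)"
  by (rule linearI) (simp_all add: fun_eq_iff lie_der_add_apply lie_der_scaleR_apply)

lemmas lie_der_simps [simp] = linear_add[OF linear_lie_der] linear_diff[OF linear_lie_der]
  linear_neg[OF linear_lie_der] linear_0[OF linear_lie_der] linear_scale[OF linear_lie_der]

lemma ce_add_apply: "ce (v + w) xs = ce v xs + ce w xs"
  by (induction xs arbitrary: v w) (simp_all add: algebra_simps)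

lemma ce_scaleR_apply: "ce (c *\<^sub>R w) xs = c *\<^sub>R ce w xs"
  by (induction xs arbitrary: w) (simp_all add: algebra_simps)

lemma linear_ce: "linear ce"
  by (rule linearI) (simp_all add: fun_eq_iff ce_add_apply ce_scaleR_apply)

lemmas ce_simps [simp] = linear_add[OF linear_ce] linear_diff[OF linear_ce]
  linear_neg[OF linear_ce] linear_0[OF linear_ce] linear_scale[OF linear_ce]

lemma parity_lie_der [simp]: "parity (lie_der x w) = lie_der x (parity w)"
proof
  show "parity (lie_der x w) xs = lie_der x (parity w) xs" for xs
    by (induction xs arbitrary: w) (simp_all add: parity_Cons)
qed

lemma parity_ce [simp]: "parity (ce w) = - ce (parity w)"
proof
  show "parity (ce w) xs = (- ce (parity w)) xs" for xs
    by (induction xs arbitrary: w) (simp_all add: parity_Cons)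
qed

lemma lie_der_wedge [simp]:
  "lie_der x (wedge a b) = wedge (lie_der x a) b + wedge a (lie_der x b)"
proof
  show "lie_der x (wedge a b) xs = (wedge (lie_der x a) b + wedge a (lie_der x b)) xs" for xs
    by (induction xs arbitrary: a b) (simp_all add: algebra_simps)
qed

text \<open>
  The commutator action is by derivations, so the Lie derivative is a derivation of the product;
  Cartan's formula carries this over to the differential.
\<close>

lemma ce_wedge: "ce (wedge a b) = wedge (ce a) b + wedge (parity a) (ce b)"
proof
  show "ce (wedge a b) xs = (wedge (ce a) b + wedge (parity a) (ce b)) xs" for xs
    by (induction xs arbitrary: a b) (simp_all add: algebra_simps)
qed

text \<open>
  For the values this is the representation property of \<open>D\<close>, for the arguments the Jacobi identity.
  Linearity of the form is used to split the inserted double bracket.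
\<close>

lemma lie_der_lie_der:
  assumes "multilinear w"
  shows "lie_der x (lie_der y w) - lie_der y (lie_der x w) = lie_der (br x y) w"
proof
  show "(lie_der x (lie_der y w) - lie_der y (lie_der x w)) xs = lie_der (br x y) w xs" for xs
    using assms
  proof (induction xs arbitrary: w)
    case Nil
    then show ?case by (simp add: D_br algebra_simps)
  next
    case (Cons z xs)
    have "contract (br (br x y) z) w = contract (br x (br y z)) w - contract (br y (br x z)) w"
      by (simp add: br_br linear_diff[OF linear_contract[OF Cons.prems]])
    then have "contract (br (br x y) z) w xs = contract (br x (br y z)) w xs - contract (br y (br x z)) w xs"
      by simp
    then have "w (br (br x y) z # xs) = w (br x (br y z) # xs) - w (br y (br x z) # xs)"
      by (simp add: contract_def)
    with Cons.IH[OF multilinear_contract[OF Cons.prems], of z] show ?case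
      by (simp add: algebra_simps)
  qed
qed

lemma multilinear_lie_der:
  assumes "multilinear w"
  shows "multilinear (lie_der z w)"
proof -
  have "linear (\<lambda>x. lie_der z w (xs @ x # ys))" for xs ys
    using assms
  proof (induction xs arbitrary: w)
    case Nil
    have 1: "linear (\<lambda>x. w (x # ys))"
      using multilinearD[OF Nil, of "[]"] by simp
    have "linear (\<lambda>x. lie_der z (contract x w) ys)"
      by (rule linearI) (simp_all add: linear_add[OF linear_contract[OF Nil]] linear_scale[OF linear_contract[OF Nil]])
    then show ?case
      using linear_compose[OF linear_br(1) 1] by (auto intro!: linear_compose_sub simp: o_def)
  next
    case (Cons y xs)
    have "linear (\<lambda>x. w (br z y # xs @ x # ys))"
      using multilinearD[OF Cons.prems, of "br z y # xs"] by simp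
    then show ?case
      using Cons.IH[OF multilinear_contract[OF Cons.prems]] by (auto intro!: linear_compose_sub)
  qed
  then show ?thesis by (simp add: multilinear_def)
qed

lemma linear_lie_der_left:
  assumes "multilinear w"
  shows "linear (\<lambda>x. lie_der x w xs)"
  using assms
proof (induction xs arbitrary: w)
  case Nil
  then show ?case
    by (auto intro!: linearI simp: linear_add[OF linear_D] linear_scale[OF linear_D] algebra_simps)
next
  case (Cons y ys)
  have "linear (\<lambda>x. w (x # ys))"
    using multilinearD[OF Cons.prems, of "[]"] by simp
  then show ?case
    using Cons.IH[OF multilinear_contract[OF Cons.prems]] linear_compose[OF linear_br(2)]
    by (auto intro!: linear_compose_sub simp: o_def)
qed

lemma multilinear_ce:
  assumes "multilinear w"
  shows "multilinear (ce w)"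
proof -
  have "linear (\<lambda>x. ce w (xs @ x # ys))" for xs ys
    using assms
  proof (induction xs arbitrary: w)
    case Nil
    have "linear (\<lambda>x. ce (contract x w) ys)"
      by (rule linearI) (simp_all add: linear_add[OF linear_contract[OF Nil]] linear_scale[OF linear_contract[OF Nil]])
    then show ?case
      using linear_lie_der_left[OF Nil] by (auto intro!: linear_compose_sub)
  next
    case (Cons y xs)
    then show ?case
      using multilinearD[OF multilinear_lie_der[OF Cons.prems, of y]]
      by (auto intro!: linear_compose_sub multilinear_contract)
  qed
  then show ?thesis by (simp add: multilinear_def)
qed

text \<open>
  Contracting \<open>ce w\<close> twice with \<open>x\<close> leaves the contraction of \<open>w\<close> with \<open>br x x\<close>, which vanishes.
\<close>

lemma alternating_ce:
  assumes "multilinear w" "alternating w"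
  shows "alternating (ce w)"
proof -
  have "lie_der z w (xs @ x # x # ys) = 0" if "multilinear w" "alternating w" for z w xs x ys
    using that
  proof (induction xs arbitrary: w)
    case Nil
    have "w (br z x # x # ys) + w (x # br z x # ys) = 0"
      using alternating_swap[OF Nil, of "[]" x "br z x" ys] by simp
    then show ?case
      using Nil(2) by (simp add: alternating_contract_contract) (simp add: contract_def add_eq_0_iff2)
  next
    case (Cons y xs)
    have "w (br z y # xs @ x # x # ys) = 0"
      using alternatingD[OF Cons.prems(2), of "br z y # xs"] by simp
    then show ?case
      using Cons by (simp add: multilinear_contract alternating_contract)
  qed
  then have lie: "alternating (lie_der z w)" if "multilinear w" "alternating w" for z w
    using that by (simp add: alternating_def)
  have "ce w (xs @ x # x # ys) = 0" for xs x ys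
    using assms
  proof (induction xs arbitrary: w)
    case Nil
    then show ?case
      using linear_0[OF linear_contract[OF Nil(1)]]
      by (simp add: alternating_contract_contract) (simp add: contract_def fun_eq_iff)
  next
    case (Cons y xs)
    then show ?case
      using lie[OF Cons.prems, of y]
      by (simp add: alternating_def[of "lie_der _ _"] multilinear_contract alternating_contract)
  qed
  then show ?thesis by (simp add: alternating_def)
qed

text \<open>
  Contraction with \<open>y\<close> reduces the commutator of \<open>lie_der x\<close> and \<open>ce\<close> to the same commutator on
  \<open>contract y w\<close>, up to sign and terms that cancel by \<open>lie_der_lie_der\<close>.
\<close>

lemma lie_der_ce:
  assumes "multilinear w"
  shows "lie_der x (ce w) = ce (lie_der x w)"
proof
  show "lie_der x (ce w) xs = ce (lie_der x w) xs" for xs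
    using assms
  proof (induction xs arbitrary: w)
    case (Cons y ys)
    have "lie_der x (lie_der y w) ys - lie_der y (lie_der x w) ys = lie_der (br x y) w ys"
      using lie_der_lie_der[OF Cons.prems, of x y] by (simp add: fun_eq_iff)
    moreover have "ce w (br x y # ys) = lie_der (br x y) w ys - ce (contract (br x y) w) ys"
      by simp
    ultimately show ?case
      using Cons.IH[OF multilinear_contract[OF Cons.prems], of y]
      by (simp add: algebra_simps)
  qed simp
qed

text \<open>
  By Cartan's formula \<open>contract x (ce (ce w))\<close> is the commutator of \<open>lie_der x\<close> and \<open>ce\<close> applied to
  \<open>w\<close>, plus \<open>ce (ce (contract x w))\<close>.
\<close>

lemma ce_ce:
  assumes "multilinear w"
  shows "ce (ce w) = 0"
proof
  show "ce (ce w) xs = 0 xs" for xs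
    using assms
    by (induction xs arbitrary: w) (simp_all add: lie_der_ce multilinear_contract)
qed

lemma of_degree_ce:
  assumes "of_degree k w"
  shows "of_degree (Suc k) (ce w)"
proof -
  have 1: "lie_der x w xs = 0" if "length xs \<noteq> k" "of_degree k w" for x w xs k
    using that
  proof (induction xs arbitrary: w k)
    case (Cons y ys)
    then have "w (br x y # ys) = 0" by (simp add: of_degree_def)
    with Cons show ?case
      by (cases k) (auto simp: of_degree_0_contract of_degree_contract)
  qed (simp add: of_degree_def)
  have "ce w xs = 0" if "length xs \<noteq> Suc k" for xs
    using that assms
  proof (induction xs arbitrary: w k)
    case (Cons y ys)
    then have "lie_der y w ys = 0" using 1[of ys k w y] by simp
    with Cons show ?case
      by (cases k) (auto simp: of_degree_0_contract of_degree_contract)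
  qed simp
  then show ?thesis by (simp add: of_degree_def)
qed

end

section \<open>Sums over permutations that increase on blocks\<close>

text \<open>
  In one-line notation: raise all entries of \<open>\<tau>\<close> by one and insert \<open>0\<close> at position \<open>p\<close>. Every
  permutation of one more element arises in this way, with \<open>p\<close> the preimage of \<open>0\<close>.
\<close>

definition insert_perm :: "nat \<Rightarrow> (nat \<Rightarrow> nat) \<Rightarrow> nat \<Rightarrow> nat" where
  "insert_perm p \<tau> i = (if i < p then Suc (\<tau> i) else if i = p then 0 else Suc (\<tau> (i - 1)))"

lemma insert_perm_eq_0 [simp]: "insert_perm p \<tau> i = 0 \<longleftrightarrow> i = p"
  by (auto simp: insert_perm_def)

lemma insert_perm_Suc:
  "insert_perm (Suc p) \<tau> = insert_perm p \<tau> \<circ> Transposition.transpose p (Suc p)"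
  by (auto simp: fun_eq_iff insert_perm_def Transposition.transpose_def)

lemma insert_perm_0:
  assumes "\<tau> permutes {..<n}"
  shows "insert_perm 0 \<tau> = map_permutation {..<n} Suc \<tau>"
proof
  fix i
  show "insert_perm 0 \<tau> i = map_permutation {..<n} Suc \<tau> i"
  proof (cases i)
    case (Suc j)
    then show ?thesis
      using permutes_not_in[OF assms, of j]
      by (cases "j < n") (auto simp: insert_perm_def map_permutation_def restrict_id_def image_iff inv_into_f_f)
  qed (auto simp: insert_perm_def map_permutation_def restrict_id_def image_iff)
qed

lemma insert_perm_permutes:
  assumes "\<tau> permutes {..<n}" "p \<le> n"
  shows "insert_perm p \<tau> permutes {..<Suc n}"
  using assms(2)
proof (induction p)
  case 0
  have "insert_perm 0 \<tau> permutes (Suc ` {..<n})"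
    unfolding insert_perm_0[OF assms(1)] by (rule map_permutation_permutes) (use assms(1) in \<open>auto intro: permutes_bij\<close>)
  then show ?case by (rule permutes_subset) auto
next
  case (Suc p)
  have "Transposition.transpose p (Suc p) permutes {..<Suc n}"
    using Suc.prems by (intro permutes_swap_id) auto
  then show ?case
    unfolding insert_perm_Suc using Suc by (intro permutes_compose) auto
qed

text \<open>
  Moving the inserted \<open>0\<close> one position to the right is a transposition.
\<close>

lemma sign_insert_perm:
  assumes "\<tau> permutes {..<n}" "p \<le> n"
  shows "sign (insert_perm p \<tau>) = (-1) ^ p * sign \<tau>"
  using assms(2)
proof (induction p)
  case 0
  show ?case
    unfolding insert_perm_0[OF assms(1)] using assms(1) by (simp add: sign_map_permutation)
next
  case (Suc p)
  then have "permutation (insert_perm p \<tau>)"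
    using insert_perm_permutes[OF assms(1), of p] by (auto intro: permutes_imp_permutation)
  then show ?case
    unfolding insert_perm_Suc using Suc
    by (subst sign_compose) (simp_all add: permutation_swap_id sign_swap_id)
qed

lemma inj_insert_perm: "inj (insert_perm p)"
proof (rule injI, rule ext)
  fix \<tau> \<tau>' :: "nat \<Rightarrow> nat" and i
  assume eq: "insert_perm p \<tau> = insert_perm p \<tau>'"
  show "\<tau> i = \<tau>' i"
    using fun_cong[OF eq, of i] fun_cong[OF eq, of "Suc i"]
    by (cases "i < p") (auto simp: insert_perm_def)
qed

lemma permutes_eq_insert_perm:
  assumes "\<rho> permutes {..<Suc n}" "\<rho> p = 0"
  obtains \<tau> where "\<tau> permutes {..<n}" "\<rho> = insert_perm p \<tau>" "p \<le> n"
proof -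
  define up where "up i = (if i < p then i else Suc i)" for i
  define \<tau> where "\<tau> i = \<rho> (up i) - 1" for i
  have inj: "\<rho> i = \<rho> j \<longleftrightarrow> i = j" for i j
    using permutes_inj[OF assms(1)] by (auto dest: injD)
  have pos: "\<rho> (up i) = Suc (\<tau> i)" for i
    using inj[of "up i" p] assms(2) by (auto simp: \<tau>_def up_def)
  have p: "p \<le> n"
    using permutes_not_in[OF assms(1), of p] assms(2) by fastforce
  have "\<tau> permutes {..<n}"
  proof (rule inj_imp_permutes)
    show "inj_on \<tau> {..<n}"
    proof (rule inj_onI)
      fix i j assume "\<tau> i = \<tau> j"
      then have "\<rho> (up i) = \<rho> (up j)" by (simp add: pos)
      then show "i = j" unfolding inj by (auto simp: up_def split: if_splits)
    qed
    fix i
    show "i \<in> {..<n} \<Longrightarrow> \<tau> i \<in> {..<n}"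
      using permutes_in_image[OF assms(1), of "up i"] pos[of i] by (auto simp: up_def split: if_splits)
    show "i \<notin> {..<n} \<Longrightarrow> \<tau> i = i"
      using permutes_not_in[OF assms(1), of "up i"] p by (auto simp: up_def \<tau>_def)
  qed simp
  moreover have "\<rho> = insert_perm p \<tau>"
  proof
    fix i
    show "\<rho> i = insert_perm p \<tau> i"
      using pos[of i] pos[of "i - 1"] assms(2)
      by (cases i) (auto simp: insert_perm_def up_def split: if_splits)
  qed
  ultimately show ?thesis using p that by blast
qed

lemma perm_list_insert_perm:
  assumes "p \<le> length xs"
  shows "perm_list (insert_perm p \<tau>) (x # xs) = take p (perm_list \<tau> xs) @ x # drop p (perm_list \<tau> xs)"
  by (rule nth_equalityI)
    (use assms in \<open>auto simp: perm_list_def nth_append nth_Cons' insert_perm_def simp del: upt_Suc\<close>)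

text \<open>
  \<open>i < j\<close> are positions in the same one of three consecutive blocks of lengths \<open>k\<close>, \<open>m\<close>, \<open>l\<close>.
\<close>

definition in_block :: "nat \<Rightarrow> nat \<Rightarrow> nat \<Rightarrow> nat \<Rightarrow> nat \<Rightarrow> bool" where
  "in_block k m l i j \<longleftrightarrow> i < j \<and> (j < k \<or> k \<le> i \<and> j < k + m \<or> k + m \<le> i \<and> j < k + m + l)"

lemma block_perms_3:
  "\<tau> \<in> block_perms [k, m, l] \<longleftrightarrow>
     \<tau> permutes {..<k + m + l} \<and> (\<forall>i j. in_block k m l i j \<longrightarrow> \<tau> i < \<tau> j)"
  by (auto simp: block_perms_def in_block_def strict_mono_on_def less_Suc_eq numeral_3_eq_3 add.assoc)

lemma block_perms_2: "block_perms [k, l] = block_perms [k, l, 0]"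
  by (auto simp: block_perms_def strict_mono_on_def less_Suc_eq numeral_3_eq_3)

lemma block_perms_0: "block_perms [0, 0, 0] = {id}"
  by (auto simp: block_perms_3 in_block_def)

lemma finite_block_perms: "finite (block_perms bs)"
  by (rule finite_subset[OF _ finite_permutations[of "{..<sum_list bs}"]]) (auto simp: block_perms_def)

text \<open>
  An inserted \<open>0\<close> at the start of a block is smaller than the rest of the block and leaves the order
  of the other entries unchanged.
\<close>

lemma insert_perm_in_block_perms:
  assumes "\<tau> permutes {..<n}"
  shows "n = k + m + l \<Longrightarrow> insert_perm 0 \<tau> \<in> block_perms [Suc k, m, l] \<longleftrightarrow> \<tau> \<in> block_perms [k, m, l]"
    and "n = k + m + l \<Longrightarrow> insert_perm k \<tau> \<in> block_perms [k, Suc m, l] \<longleftrightarrow> \<tau> \<in> block_perms [k, m, l]"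
    and "n = k + m + l \<Longrightarrow> insert_perm (k + m) \<tau> \<in> block_perms [k, m, Suc l] \<longleftrightarrow> \<tau> \<in> block_perms [k, m, l]"
proof -
  have *: "(\<forall>i j. B i j \<longrightarrow> insert_perm p \<tau> i < insert_perm p \<tau> j) \<longleftrightarrow> (\<forall>i j. B' i j \<longrightarrow> \<tau> i < \<tau> j)"
    if B: "\<And>i j. B' i j \<longleftrightarrow> B (if i < p then i else Suc i) (if j < p then j else Suc j)"
       "\<And>i. B i p \<Longrightarrow> False" for B B' :: "nat \<Rightarrow> nat \<Rightarrow> bool" and p
  proof (intro iffI allI impI)
    fix i j
    assume H: "\<forall>i j. B i j \<longrightarrow> insert_perm p \<tau> i < insert_perm p \<tau> j" and "B' i j"
    then have "insert_perm p \<tau> (if i < p then i else Suc i) < insert_perm p \<tau> (if j < p then j else Suc j)"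
      using B(1) by blast
    then show "\<tau> i < \<tau> j" by (auto simp: insert_perm_def split: if_splits)
  next
    fix i j
    assume H: "\<forall>i j. B' i j \<longrightarrow> \<tau> i < \<tau> j" and Bij: "B i j"
    show "insert_perm p \<tau> i < insert_perm p \<tau> j"
    proof (cases "i = p \<or> j = p")
      case True
      then show ?thesis
        using B(2)[of i] B(2)[of p] Bij by (auto simp: insert_perm_def)
    next
      case False
      have up: "(if (if i < p then i else i - 1) < p then (if i < p then i else i - 1)
          else Suc (if i < p then i else i - 1)) = i" if "i \<noteq> p" for i
        using that by auto
      have "B' (if i < p then i else i - 1) (if j < p then j else j - 1)"
        unfolding B(1) using False Bij up[of i] up[of j] by simp
      then have "\<tau> (if i < p then i else i - 1) < \<tau> (if j < p then j else j - 1)" using H by blast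
      then show ?thesis using False by (auto simp: insert_perm_def)
    qed
  qed
  have iff: "insert_perm p \<tau> \<in> block_perms [k', m', l'] \<longleftrightarrow> \<tau> \<in> block_perms [k, m, l]"
    if "n = k + m + l" "k' + m' + l' = Suc n" "p \<le> n"
      "\<And>i j. in_block k m l i j \<longleftrightarrow>
        in_block k' m' l' (if i < p then i else Suc i) (if j < p then j else Suc j)"
      "\<And>i. in_block k' m' l' i p \<Longrightarrow> False" for p k' m' l'
    using assms insert_perm_permutes[OF assms \<open>p \<le> n\<close>] *[where B = "in_block k' m' l'" and B' = "in_block k m l" and p = p, OF that(4,5)]
    unfolding block_perms_3 that(2) that(1)[symmetric] by simp
  show "n = k + m + l \<Longrightarrow> insert_perm 0 \<tau> \<in> block_perms [Suc k, m, l] \<longleftrightarrow> \<tau> \<in> block_perms [k, m, l]"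
    by (rule iff) (auto simp: in_block_def)
  show "n = k + m + l \<Longrightarrow> insert_perm k \<tau> \<in> block_perms [k, Suc m, l] \<longleftrightarrow> \<tau> \<in> block_perms [k, m, l]"
    by (rule iff) (auto simp: in_block_def)
  show "n = k + m + l \<Longrightarrow> insert_perm (k + m) \<tau> \<in> block_perms [k, m, Suc l] \<longleftrightarrow> \<tau> \<in> block_perms [k, m, l]"
    by (rule iff) (auto simp: in_block_def)
qed

lemma block_perms_permutes: "\<tau> \<in> block_perms [k, m, l] \<Longrightarrow> \<tau> permutes {..<k + m + l}"
  by (simp add: block_perms_3)

text \<open>
  The entry \<open>0\<close> is the smallest of its block, so it stands at the start of a nonempty block.
\<close>

lemma block_perms_decompose:
  assumes "0 < k + m + l"
  shows "block_perms [k, m, l] =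
    (if k = 0 then {} else insert_perm 0 ` block_perms [k - 1, m, l]) \<union>
    ((if m = 0 then {} else insert_perm k ` block_perms [k, m - 1, l]) \<union>
     (if l = 0 then {} else insert_perm (k + m) ` block_perms [k, m, l - 1]))"
  (is "_ = ?A \<union> (?B \<union> ?C)")
proof (intro subset_antisym subsetI)
  fix \<rho> assume \<rho>: "\<rho> \<in> block_perms [k, m, l]"
  obtain n where n: "k + m + l = Suc n" using assms by (metis gr0_implies_Suc)
  have perm: "\<rho> permutes {..<Suc n}" using block_perms_permutes[OF \<rho>] by (simp add: n)
  obtain p where p: "\<rho> p = 0" using permutes_surj[OF perm] by (metis surjD)
  then obtain \<tau> where \<tau>: "\<tau> permutes {..<n}" "\<rho> = insert_perm p \<tau>" "p \<le> n"
    using permutes_eq_insert_perm[OF perm] by blast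
  have "\<not> in_block k m l (p - 1) p" using \<rho> p unfolding block_perms_3 by (metis less_zeroE)
  then consider "p = 0" "k > 0" | "p = k" "m > 0" | "p = k + m" "l > 0"
    using \<open>p \<le> n\<close> n by (auto simp: in_block_def) linarith+
  then show "\<rho> \<in> ?A \<union> (?B \<union> ?C)"
  proof cases
    case 1
    then show ?thesis using insert_perm_in_block_perms(1)[OF \<tau>(1), of "k - 1" m l] \<rho> \<tau>(2) n by auto
  next
    case 2
    then show ?thesis using insert_perm_in_block_perms(2)[OF \<tau>(1), of k "m - 1" l] \<rho> \<tau>(2) n by auto
  next
    case 3
    then show ?thesis using insert_perm_in_block_perms(3)[OF \<tau>(1), of k m "l - 1"] \<rho> \<tau>(2) n by auto
  qed
next
  fix \<rho> assume "\<rho> \<in> ?A \<union> (?B \<union> ?C)"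
  moreover have "insert_perm 0 \<tau> \<in> block_perms [k, m, l]" if "\<tau> \<in> block_perms [k - 1, m, l]" "k \<noteq> 0" for \<tau>
    using insert_perm_in_block_perms(1)[OF block_perms_permutes[OF that(1)] refl] that by simp
  moreover have "insert_perm k \<tau> \<in> block_perms [k, m, l]" if "\<tau> \<in> block_perms [k, m - 1, l]" "m \<noteq> 0" for \<tau>
    using insert_perm_in_block_perms(2)[OF block_perms_permutes[OF that(1)] refl] that by simp
  moreover have "insert_perm (k + m) \<tau> \<in> block_perms [k, m, l]" if "\<tau> \<in> block_perms [k, m, l - 1]" "l \<noteq> 0" for \<tau>
    using insert_perm_in_block_perms(3)[OF block_perms_permutes[OF that(1)] refl] that by simp
  ultimately show "\<rho> \<in> block_perms [k, m, l]" by (auto split: if_splits)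
qed

lemma sum_block_perms:
  fixes f :: "(nat \<Rightarrow> nat) \<Rightarrow> 'b::comm_monoid_add"
  assumes "0 < k + m + l"
  shows "sum f (block_perms [k, m, l]) =
    (if k = 0 then 0 else \<Sum>\<tau>\<in>block_perms [k - 1, m, l]. f (insert_perm 0 \<tau>)) +
    ((if m = 0 then 0 else \<Sum>\<tau>\<in>block_perms [k, m - 1, l]. f (insert_perm k \<tau>)) +
     (if l = 0 then 0 else \<Sum>\<tau>\<in>block_perms [k, m, l - 1]. f (insert_perm (k + m) \<tau>)))"
proof -
  have neq: "insert_perm p \<tau> \<noteq> insert_perm q \<tau>'" if "p \<noteq> q" for p q \<tau> \<tau>'
    using that by (metis insert_perm_eq_0)
  have inj: "inj_on (insert_perm p) T" for p T
    using inj_insert_perm by (rule inj_on_subset) simp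
  have re: "(\<Sum>\<tau>\<in>T. f (insert_perm p \<tau>)) = sum f (insert_perm p ` T)" for p T
    by (simp add: sum.reindex[OF inj])
  show ?thesis
    unfolding block_perms_decompose[OF assms] re
    by (subst sum.union_disjoint; (subst sum.union_disjoint)?)
       (auto simp: finite_block_perms neq)
qed

text \<open>
  The first argument \<open>x\<close> goes to the first place of one of the three blocks, that is, one of the
  three forms is contracted with it. The sign of the insertion is the sign that \<open>parity\<close> gives to
  the forms standing before it.
\<close>

lemma sum_block_perms_eq_wedge:
  fixes a b c :: "'g list \<Rightarrow> 'a::real_algebra"
  assumes "of_degree k a" "of_degree m b" "of_degree l c" "length xs = k + m + l"
  shows "(\<Sum>\<tau>\<in>block_perms [k, m, l]. of_int (sign \<tau>) *\<^sub>R
      (let ys = perm_list \<tau> xs in c (drop (k + m) ys) * b (take m (drop k ys)) * a (take k ys))) =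
    wedge (wedge a b) c xs"
  using assms
proof (induction xs arbitrary: k m l a b c)
  case Nil
  then show ?case by (simp add: block_perms_0 perm_list_def mult.assoc)
next
  case (Cons x xs)
  define F where "F k m l a b c \<tau> xs = of_int (sign \<tau>) *\<^sub>R
      (let ys = perm_list \<tau> xs in c (drop (k + m) ys) * b (take m (drop k ys)) * a (take k ys))"
    for k m l :: nat and a b c :: "'g list \<Rightarrow> 'a" and \<tau> and xs :: "'g list"
  have IH: "(\<Sum>\<tau>\<in>block_perms [k, m, l]. F k m l a b c \<tau> xs) = wedge (wedge a b) c xs"
    if "of_degree k a" "of_degree m b" "of_degree l c" "length xs = k + m + l"
    for k m l and a b c :: "'g list \<Rightarrow> 'a"
    using Cons.IH[OF that] by (simp add: F_def)
  have len: "length (perm_list \<tau> xs) = length xs" for \<tau> and xs :: "'g list"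
    by (simp add: perm_list_def)
  have 1: "(if k = 0 then 0 else \<Sum>\<tau>\<in>block_perms [k - 1, m, l]. F k m l a b c (insert_perm 0 \<tau>) (x # xs))
      = wedge (wedge (contract x a) b) c xs"
  proof (cases k)
    case 0
    then show ?thesis using Cons.prems by (simp add: of_degree_0_contract)
  next
    case (Suc k')
    have "F k m l a b c (insert_perm 0 \<tau>) (x # xs) = F k' m l (contract x a) b c \<tau> xs"
      if "\<tau> \<in> block_perms [k', m, l]" for \<tau>
      using sign_insert_perm[OF block_perms_permutes[OF that], of 0] Suc
      by (simp add: F_def Let_def perm_list_insert_perm contract_def)
    then show ?thesis
      using IH[of k' "contract x a" m b l c] Cons.prems Suc of_degree_contract[of k' a x]
      by simp
  qed
  have 2: "(if m = 0 then 0 else \<Sum>\<tau>\<in>block_perms [k, m - 1, l]. F k m l a b c (insert_perm k \<tau>) (x # xs))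
      = wedge (wedge (parity a) (contract x b)) c xs"
  proof (cases m)
    case 0
    then show ?thesis using Cons.prems by (simp add: of_degree_0_contract)
  next
    case (Suc m')
    have "F k m l a b c (insert_perm k \<tau>) (x # xs) = (-1) ^ k *\<^sub>R F k m' l a (contract x b) c \<tau> xs"
      if "\<tau> \<in> block_perms [k, m', l]" for \<tau>
      using sign_insert_perm[OF block_perms_permutes[OF that], of k] Suc Cons.prems
      by (simp add: F_def Let_def perm_list_insert_perm contract_def len add.commute)
    then show ?thesis
      using IH[of k a m' "contract x b" l c] Cons.prems Suc of_degree_contract[of m' b x]
      by (simp add: parity_of_degree flip: scaleR_sum_right)
  qed
  have 3: "(if l = 0 then 0 else \<Sum>\<tau>\<in>block_perms [k, m, l - 1]. F k m l a b c (insert_perm (k + m) \<tau>) (x # xs))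
      = wedge (wedge (parity a) (parity b)) (contract x c) xs"
  proof (cases l)
    case 0
    then show ?thesis using Cons.prems by (simp add: of_degree_0_contract)
  next
    case (Suc l')
    have "F k m l a b c (insert_perm (k + m) \<tau>) (x # xs) = (-1) ^ (k + m) *\<^sub>R F k m l' a b (contract x c) \<tau> xs"
      if "\<tau> \<in> block_perms [k, m, l']" for \<tau>
      using sign_insert_perm[OF block_perms_permutes[OF that], of "k + m"] Suc Cons.prems
      by (simp add: F_def Let_def perm_list_insert_perm contract_def len drop_take)
    then show ?thesis
      using IH[of k a m b l' "contract x c"] Cons.prems Suc of_degree_contract[of l' c x]
      by (simp add: parity_of_degree power_add mult.commute flip: scaleR_sum_right)
  qed
  have "0 < k + m + l" using Cons.prems(4) by (metis length_greater_0_conv list.distinct(1))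
  then have "(\<Sum>\<tau>\<in>block_perms [k, m, l]. F k m l a b c \<tau> (x # xs)) = wedge (wedge a b) c (x # xs)"
    by (simp only: sum_block_perms 1 2 3) (simp add: add.assoc)
  then show ?case by (simp add: F_def)
qed

section \<open>The explicit formula for the differential\<close>

lemma nths_Cons_omit:
  "nths (x # xs) (- {0}) = xs"
  "nths (x # xs) (- {Suc i}) = x # nths xs (- {i})"
  "nths (x # xs) (- {0, Suc i}) = nths xs (- {i})"
  "nths (x # xs) (- {Suc i, Suc j}) = x # nths xs (- {i, j})"
proof -
  have "{l. Suc l \<in> - {0}} = UNIV" "{l. Suc l \<in> - {Suc i}} = - {i}"
    "{l. Suc l \<in> - {0, Suc i}} = - {i}" "{l. Suc l \<in> - {Suc i, Suc j}} = - {i, j}"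
    by auto
  then show "nths (x # xs) (- {0}) = xs" "nths (x # xs) (- {Suc i}) = x # nths xs (- {i})"
    "nths (x # xs) (- {0, Suc i}) = nths xs (- {i})"
    "nths (x # xs) (- {Suc i, Suc j}) = x # nths xs (- {i, j})"
    by (simp_all only: nths_Cons) (simp_all add: nths_all)
qed

lemma nths_omit: "i < length xs \<Longrightarrow> nths xs (- {i}) = take i xs @ drop (Suc i) xs"
proof (induction xs arbitrary: i)
  case (Cons x xs)
  then show ?case by (cases i) (simp_all only: nths_Cons_omit, simp_all)
qed simp

context lie_rep
begin

lemma lie_der_explicit:
  "lie_der x w ys = D x * w ys - w ys * D x - (\<Sum>j<length ys. w (ys[j := br x (ys ! j)]))"
proof (induction ys arbitrary: w)
  case (Cons y ys)
  show ?case
    by (simp add: Cons.IH sum.lessThan_Suc_shift del: sum.lessThan_Suc) (simp add: contract_def)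
qed simp

text \<open>
  The terms in which the first argument \<open>x\<close> acts or enters a bracket make up \<open>lie_der x w\<close>, once the
  bracket has been moved to the place of its second entry; the other terms are those of
  \<open>contract x w\<close> with opposite sign. Both steps use that \<open>w\<close> is alternating.
\<close>

lemma ce_explicit:
  assumes "multilinear w" "alternating w"
  shows "ce w xs =
    (\<Sum>i<length xs. (-1) ^ i *\<^sub>R (D (xs ! i) * w (nths xs (- {i})) - w (nths xs (- {i})) * D (xs ! i))) +
    (\<Sum>j<length xs. \<Sum>i<j. (-1) ^ (i + j) *\<^sub>R w (br (xs ! i) (xs ! j) # nths xs (- {i, j})))"
  using assms
proof (induction xs arbitrary: w)
  case (Cons x xs)
  have "(-1) ^ j *\<^sub>R w (br x (xs ! j) # nths xs (- {j})) = w (xs[j := br x (xs ! j)])" if "j < length xs" for j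
    using alternating_move[OF Cons.prems, of "[]" "br x (xs ! j)" "take j xs" "drop (Suc j) xs"] that
    by (simp add: nths_omit upd_conv_take_nth_drop flip: power_add)
  then have *: "(\<Sum>j<length xs. (-1) ^ j *\<^sub>R w (br x (xs ! j) # nths xs (- {j})))
      = (\<Sum>j<length xs. w (xs[j := br x (xs ! j)]))"
    by simp
  have sw: "w (y # x # zs) = - contract x w (y # zs)" for y zs
    using alternating_swap[OF Cons.prems, of "[]" y x zs] by (simp add: contract_def)
  have IH: "ce (contract x w) xs =
    (\<Sum>i<length xs. (-1) ^ i *\<^sub>R (D (xs ! i) * w (x # nths xs (- {i})) - w (x # nths xs (- {i})) * D (xs ! i))) +
    (\<Sum>j<length xs. \<Sum>i<j. (-1) ^ (i + j) *\<^sub>R contract x w (br (xs ! i) (xs ! j) # nths xs (- {i, j})))"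
    using Cons.IH[OF multilinear_contract[OF Cons.prems(1)] alternating_contract[OF Cons.prems(2)]]
    by (simp add: contract_def)
  show ?case
    by (simp add: IH lie_der_explicit sum.lessThan_Suc_shift nths_Cons_omit sw * sum.distrib
        sum_negf sum_subtractf algebra_simps del: sum.lessThan_Suc)
qed simp

end

section \<open>The algebra of linear endomorphisms\<close>

text \<open>
  A type of linear maps makes composition bilinear without side conditions, so that the calculus of
  forms applies with composition as product.
\<close>

typedef (overloaded) 'g endo = "{f :: 'g::real_vector \<Rightarrow> 'g. linear f}"
  morphisms app Endo
  by (rule exI[of _ "\<lambda>_. 0"]) (simp add: linear_zero)

setup_lifting type_definition_endo

lemma linear_app: "linear (app f)"
  using app[of f] by simp

instantiation endo :: (real_vector) real_algebra
begin

lift_definition zero_endo :: "'a endo" is "\<lambda>_. 0" by (rule linear_zero)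
lift_definition plus_endo :: "'a endo \<Rightarrow> 'a endo \<Rightarrow> 'a endo" is "\<lambda>f g x. f x + g x"
  by (rule linear_compose_add)
lift_definition minus_endo :: "'a endo \<Rightarrow> 'a endo \<Rightarrow> 'a endo" is "\<lambda>f g x. f x - g x"
  by (rule linear_compose_sub)
lift_definition uminus_endo :: "'a endo \<Rightarrow> 'a endo" is "\<lambda>f x. - f x"
  by (rule linear_compose_neg)
lift_definition times_endo :: "'a endo \<Rightarrow> 'a endo \<Rightarrow> 'a endo" is "\<lambda>f g x. f (g x)"
  using linear_compose by (auto simp: o_def)
lift_definition scaleR_endo :: "real \<Rightarrow> 'a endo \<Rightarrow> 'a endo" is "\<lambda>c f x. c *\<^sub>R f x"
  by (rule linear_compose_scale_right)

instance
  by standard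
    (transfer; simp add: fun_eq_iff algebra_simps linear_add linear_scale)+

end

lemma app_simps [simp]:
  "app 0 x = 0" "app (f + g) x = app f x + app g x" "app (f - g) x = app f x - app g x"
  "app (- f) x = - app f x" "app (f * g) x = app f (app g x)" "app (c *\<^sub>R f) x = c *\<^sub>R app f x"
  by (transfer, simp)+

lemma app_Endo: "linear f \<Longrightarrow> app (Endo f) = f"
  by (simp add: Endo_inverse)

lemma endo_eqI: "(\<And>x. app f x = app g x) \<Longrightarrow> f = g"
  by (simp add: app_inject[symmetric] fun_eq_iff)

lemma app_sum: "app (sum f S) v = (\<Sum>i\<in>S. app (f i) v)"
  by (induction S rule: infinite_finite_induct) simp_all

section \<open>The bracket defined by a closed one-form\<close>

lemma wedge_mult_left: "wedge a (\<lambda>xs. p * b xs) xs = p * wedge a b xs"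
proof (induction xs arbitrary: a b)
  case (Cons x xs)
  have "contract x (\<lambda>xs. p * b xs) = (\<lambda>xs. p * contract x b xs)" by (simp add: contract_def)
  then show ?case by (simp add: Cons.IH distrib_left)
qed (simp add: mult.assoc)

lemma wedge_mult_right: "wedge (\<lambda>xs. a xs * q) b xs = wedge a b xs * q"
proof (induction xs arbitrary: a b)
  case (Cons x xs)
  have "contract x (\<lambda>xs. a xs * q) = (\<lambda>xs. contract x a xs * q)" "parity (\<lambda>xs. a xs * q) = (\<lambda>xs. parity a xs * q)"
    by (simp_all add: contract_def parity_def)
  then show ?case by (simp add: Cons.IH distrib_right)
qed (simp add: mult.assoc)

context lie_rep
begin

lemma ce_mult_left:
  assumes "\<And>x. p * D x = D x * p"
  shows "ce (\<lambda>xs. p * w xs) xs = p * ce w xs"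
proof -
  have c: "contract x (\<lambda>xs. p * w xs) = (\<lambda>xs. p * contract x w xs)" for x w by (simp add: contract_def)
  have l: "lie_der x (\<lambda>xs. p * w xs) xs = p * lie_der x w xs" for x w xs
  proof (induction xs arbitrary: w)
    case Nil
    then show ?case by (simp add: right_diff_distrib assms flip: mult.assoc)
  qed (simp add: c right_diff_distrib)
  show ?thesis
    by (induction xs arbitrary: w) (simp_all add: c l right_diff_distrib)
qed

lemma ce_mult_right:
  assumes "\<And>x. q * D x = D x * q"
  shows "ce (\<lambda>xs. w xs * q) xs = ce w xs * q"
proof -
  have c: "contract x (\<lambda>xs. w xs * q) = (\<lambda>xs. contract x w xs * q)" for x w by (simp add: contract_def)
  have l: "lie_der x (\<lambda>xs. w xs * q) xs = lie_der x w xs * q" for x w xs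
  proof (induction xs arbitrary: w)
    case Nil
    then show ?case by (simp add: left_diff_distrib assms mult.assoc)
  qed (simp add: c left_diff_distrib)
  show ?thesis
    by (induction xs arbitrary: w) (simp_all add: c l left_diff_distrib)
qed

end

text \<open>
  For forms whose products with each other vanish, \<open>bracket k l a b\<close> is the graded commutator of
  \<open>\<beta>\<close> with \<open>a\<close> and then with \<open>b\<close>: only the two terms with \<open>\<beta>\<close> in the middle remain.
\<close>

locale derived_bracket = lie_rep br D
  for br :: "'g::real_vector \<Rightarrow> 'g \<Rightarrow> 'g" and D :: "'g \<Rightarrow> 'a::real_algebra" +
  fixes \<beta> :: "'g list \<Rightarrow> 'a"
  assumes degree_beta: "of_degree 1 \<beta>"
    and ce_beta [simp]: "ce \<beta> = 0"
begin

definition brace :: "('g list \<Rightarrow> 'a) \<Rightarrow> ('g list \<Rightarrow> 'a) \<Rightarrow> 'g list \<Rightarrow> 'a" where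
  "brace a b = wedge (wedge a \<beta>) b"

definition bracket :: "nat \<Rightarrow> nat \<Rightarrow> ('g list \<Rightarrow> 'a) \<Rightarrow> ('g list \<Rightarrow> 'a) \<Rightarrow> 'g list \<Rightarrow> 'a" where
  "bracket k l a b = - ((-1) ^ k *\<^sub>R brace a b) - (-1) ^ ((k + 1) * l) *\<^sub>R brace b a"

lemma brace_simps [simp]:
  "brace (a + a') b = brace a b + brace a' b" "brace a (b + b') = brace a b + brace a b'"
  "brace (a - a') b = brace a b - brace a' b" "brace a (b - b') = brace a b - brace a b'"
  "brace (- a) b = - brace a b" "brace a (- b) = - brace a b"
  "brace (c *\<^sub>R a) b = c *\<^sub>R brace a b" "brace a (c *\<^sub>R b) = c *\<^sub>R brace a b"
  "brace 0 b = 0" "brace a 0 = 0"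
  by (simp_all add: brace_def)

lemma brace_assoc: "brace (brace a b) c = brace a (brace b c)"
  by (simp add: brace_def wedge_assoc)

lemma parity_beta: "parity \<beta> = - \<beta>"
  using parity_of_degree[OF degree_beta] by simp

lemma ce_brace: "of_degree k a \<Longrightarrow> ce (brace a b) = brace (ce a) b - (-1) ^ k *\<^sub>R brace a (ce b)"
  by (simp add: brace_def ce_wedge parity_beta parity_of_degree[of k a])

lemma of_degree_brace: "of_degree k a \<Longrightarrow> of_degree l b \<Longrightarrow> of_degree (k + l + 1) (brace a b)"
  using of_degree_wedge[OF of_degree_wedge[OF _ degree_beta], of k a l b] by (simp add: brace_def)

lemma of_degree_bracket:
  assumes "of_degree k a" "of_degree l b"
  shows "of_degree (k + l + 1) (bracket k l a b)"
  using of_degree_brace[OF assms] of_degree_brace[OF assms(2,1)]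
  by (simp add: bracket_def add.commute)

lemma bracket_symmetric: "bracket k l a b = (-1) ^ (k * l) *\<^sub>R bracket l k b a"
  by (simp add: bracket_def minus_one_power_iff algebra_simps)

text \<open>
  The derivation rule for \<open>brace\<close> contains no term with \<open>ce \<beta>\<close>; the four remaining terms cancel
  against the two brackets.
\<close>

lemma jacobi_2:
  assumes "of_degree k a" "of_degree l b"
  shows "ce (bracket k l a b) + bracket (Suc k) l (ce a) b + (-1) ^ (k * l) *\<^sub>R bracket (Suc l) k (ce b) a = 0"
  by (simp add: bracket_def ce_brace[OF assms(1)] ce_brace[OF assms(2)] minus_one_power_iff algebra_simps)

text \<open>
  By associativity each bracket of a bracket is a combination of products of \<open>a\<close>, \<open>b\<close>, \<open>c\<close> separated
  by \<open>\<beta>\<close>. Each order of the three factors occurs twice, once with either placement of the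
  parentheses, and with opposite signs.
\<close>

lemma jacobi_3:
  "bracket (Suc (k + l)) m (bracket k l a b) c
    + (-1) ^ (l * m) *\<^sub>R bracket (Suc (k + m)) l (bracket k m a c) b
    + (-1) ^ (k * l + k * m) *\<^sub>R bracket (Suc (l + m)) k (bracket l m b c) a = 0"
  by (simp add: bracket_def brace_assoc minus_one_power_iff algebra_simps)

end

section \<open>The splitting along an ideal\<close>

locale split_ideal = lie_bracket br
  for br :: "'g::real_vector \<Rightarrow> 'g \<Rightarrow> 'g" +
  fixes I :: "'g set"
    and \<pi> :: "'g \<Rightarrow> 'q::real_vector" and \<sigma> :: "'q \<Rightarrow> 'g"
  assumes ideal: "lie_ideal br I" and quotient: "quotient_map I \<pi>"
    and linear_sigma: "linear \<sigma>" and pi_sigma [simp]: "\<And>q. \<pi> (\<sigma> q) = q"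
begin

lemma linear_pi: "linear \<pi>" and I_iff: "u \<in> I \<longleftrightarrow> \<pi> u = 0"
  using quotient by (auto simp: quotient_map_def)

lemmas linear_simps [simp] = linear_add[OF linear_pi] linear_diff[OF linear_pi] linear_neg[OF linear_pi]
  linear_0[OF linear_pi] linear_scale[OF linear_pi]
  linear_add[OF linear_sigma] linear_diff[OF linear_sigma] linear_neg[OF linear_sigma]
  linear_0[OF linear_sigma] linear_scale[OF linear_sigma]
  linear_add[OF linear_br(1)] linear_diff[OF linear_br(1)] linear_neg[OF linear_br(1)]
  linear_0[OF linear_br(1)] linear_scale[OF linear_br(1)]
  linear_add[OF linear_br(2)] linear_diff[OF linear_br(2)] linear_neg[OF linear_br(2)]
  linear_0[OF linear_br(2)] linear_scale[OF linear_br(2)]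

abbreviation prI :: "'g \<Rightarrow> 'g" where "prI \<equiv> pr \<pi> \<sigma>"

lemma linear_pr: "linear prI"
  by (rule linearI) (simp_all add: pr_def algebra_simps)

lemma pi_pr [simp]: "\<pi> (prI v) = 0"
  by (simp add: pr_def)

lemma pr_in_I [simp]: "prI v \<in> I"
  by (simp add: I_iff)

lemma pr_id: "\<pi> u = 0 \<Longrightarrow> prI u = u"
  by (simp add: pr_def)

lemma pr_pr [simp]: "prI (prI v) = prI v"
  by (simp add: pr_id)

lemma pr_sigma [simp]: "prI (\<sigma> q) = 0"
  by (simp add: pr_def)

lemma pi_br: "\<pi> u = 0 \<Longrightarrow> \<pi> (br x u) = 0"
  using ideal by (simp add: lie_ideal_def I_iff)

lemma pi_br_sigma [simp]: "\<pi> (br x (\<sigma> (\<pi> v))) = \<pi> (br x v)"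
  using pi_br[of "prI v" x] by (simp add: pr_def)

lemma pi_br_br [simp]: "\<pi> (br y (br x (\<sigma> (\<pi> v)))) = \<pi> (br y (br x v))"
  using pi_br[OF pi_br[of "prI v" x], of y] by (simp add: pr_def)

text \<open>
  The block-diagonal part and the corner block from the complement to the ideal of the adjoint
  representation.
\<close>

definition split_action :: "'g \<Rightarrow> 'g endo" where
  "split_action x = Endo (\<lambda>v. br x (prI v) + \<sigma> (\<pi> (br x v)))"

definition beta :: "'g list \<Rightarrow> 'g endo" where
  "beta xs = (case xs of [x] \<Rightarrow> Endo (\<lambda>v. prI (br x (\<sigma> (\<pi> v)))) | _ \<Rightarrow> 0)"

definition to_ideal :: "'g endo" where "to_ideal = Endo prI"
definition to_complement :: "'g endo" where "to_complement = Endo (\<lambda>v. \<sigma> (\<pi> v))"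

lemmas linear_pr_simps [simp] = linear_add[OF linear_pr] linear_diff[OF linear_pr]
  linear_neg[OF linear_pr] linear_0[OF linear_pr] linear_scale[OF linear_pr]

lemma app_split_action [simp]: "app (split_action x) v = br x (prI v) + \<sigma> (\<pi> (br x v))"
  unfolding split_action_def
  by (subst app_Endo) (auto intro!: linearI simp: algebra_simps)

lemma app_beta [simp]: "app (beta [x]) v = prI (br x (\<sigma> (\<pi> v)))"
  unfolding beta_def by (simp, subst app_Endo) (auto intro!: linearI)

lemma beta_eq_0 [simp]: "beta [] = 0" "beta (x # y # zs) = 0"
  by (simp_all add: beta_def)

lemma app_to_ideal [simp]: "app to_ideal v = prI v" and app_to_complement [simp]: "app to_complement v = \<sigma> (\<pi> v)"
  by (simp_all add: to_ideal_def to_complement_def app_Endo linear_pr linear_compose[OF linear_pi linear_sigma, unfolded o_def])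

text \<open>
  On \<open>I\<close> this is the adjoint action, on the complement the action of the quotient.
\<close>

sublocale lie_rep br split_action
proof (intro lie_rep.intro lie_rep_axioms.intro lie_bracket_axioms)
  show "linear split_action"
    by (rule linearI; rule endo_eqI) (simp_all add: algebra_simps)
  show "split_action (br x y) = split_action x * split_action y - split_action y * split_action x" for x y
    by (rule endo_eqI) (simp add: pr_id pi_br br_br algebra_simps)
qed

text \<open>
  On two arguments, \<open>ce beta\<close> is the component from the complement to the ideal of the difference between
  \<open>br x (br y v) - br y (br x v)\<close> and \<open>br (br x y) v\<close>, hence zero by the Jacobi identity.
\<close>

sublocale derived_bracket br split_action beta
proof
  show deg: "of_degree 1 beta"
    by (auto simp: of_degree_def beta_def split: list.split)
  have "ce beta [x, y] = 0" for x y
    by (rule endo_eqI)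
       (simp add: contract_def pr_id pi_br, simp add: pr_def pi_br br_br algebra_simps)
  then have "ce beta xs = 0" for xs
  proof (cases "length xs = 2")
    case True
    then obtain x y where "xs = [x, y]" by (auto simp: numeral_2_eq_2 length_Suc_conv)
    then show ?thesis using \<open>\<And>x y. ce beta [x, y] = 0\<close> by simp
  qed (use of_degree_ce[OF deg] in \<open>simp add: of_degree_def\<close>)
  then show "ce beta = 0" by (simp add: fun_eq_iff)
qed

section \<open>Cochains as forms with values in endomorphisms\<close>

text \<open>
  A cochain takes values in maps that are linear on \<open>I\<close> only. Precomposing with the projection onto
  \<open>I\<close> and composing with \<open>\<sigma>\<close> turns the values into endomorphisms; \<open>cochain_of\<close> is the inverse on
  forms whose values lie in the corner block from \<open>I\<close> to the complement.
\<close>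

definition endo_form :: "('g list \<Rightarrow> 'g \<Rightarrow> 'q) \<Rightarrow> 'g list \<Rightarrow> 'g endo" where
  "endo_form w xs = Endo (\<lambda>v. \<sigma> (w xs (prI v)))"

definition cochain_of :: "('g list \<Rightarrow> 'g endo) \<Rightarrow> 'g list \<Rightarrow> 'g \<Rightarrow> 'q" where
  "cochain_of F xs u = (if u \<in> I then \<pi> (app (F xs) u) else 0)"

definition off_diagonal :: "('g list \<Rightarrow> 'g endo) \<Rightarrow> bool" where
  "off_diagonal F \<longleftrightarrow> (\<lambda>xs. to_complement * F xs) = F \<and> (\<lambda>xs. F xs * to_ideal) = F"

abbreviation "C \<equiv> (cochains I :: nat \<Rightarrow> ('g list \<Rightarrow> 'g \<Rightarrow> 'q) set)"

lemma cochain_lin: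
  assumes "w \<in> C k" "u \<in> I" "v \<in> I"
  shows "w xs (u + v) = w xs u + w xs v" "w xs (c *\<^sub>R u) = c *\<^sub>R w xs u"
proof -
  have *: "w xs (a *\<^sub>R u + b *\<^sub>R v) = a *\<^sub>R w xs u + b *\<^sub>R w xs v" for a b
    using assms by (auto simp: cochains_def)
  show "w xs (u + v) = w xs u + w xs v" "w xs (c *\<^sub>R u) = c *\<^sub>R w xs u"
    using *[of 1 1] *[of c 0] by simp_all
qed

lemma cochain_0: "w \<in> C k \<Longrightarrow> length xs \<noteq> k \<or> u \<notin> I \<Longrightarrow> w xs u = 0"
  by (simp add: cochains_def)

lemma app_endo_form: "w \<in> C k \<Longrightarrow> app (endo_form w xs) v = \<sigma> (w xs (prI v))"
  unfolding endo_form_def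
  by (subst app_Endo) (auto intro!: linearI simp: cochain_lin(1) cochain_lin(2)[where v = 0] I_iff)

lemma subspace_cochains: "subspace (C k)"
proof (rule subspaceI)
  show "0 \<in> C k" by (simp add: cochains_def linear_zero)
  show "v + w \<in> C k" if "v \<in> C k" "w \<in> C k" for v w
    using that by (auto simp: cochains_def algebra_simps intro!: linear_compose_add)
  show "c *\<^sub>R w \<in> C k" if "w \<in> C k" for c w
    using that by (auto simp: cochains_def algebra_simps intro!: linear_compose_scale_right)
qed

lemma endo_form_0 [simp]: "endo_form 0 = 0"
  by (auto simp: fun_eq_iff app_endo_form[OF subspace_0[OF subspace_cochains]] intro!: endo_eqI)

lemma endo_form_lincomb:
  assumes "v \<in> C k" "w \<in> C k"
  shows "endo_form (c *\<^sub>R v + w) = c *\<^sub>R endo_form v + endo_form w"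
proof -
  have "c *\<^sub>R v + w \<in> C k"
    using assms by (intro subspace_add subspace_scale subspace_cochains)
  then show ?thesis
    using assms by (auto simp: fun_eq_iff app_endo_form intro!: endo_eqI)
qed

lemma of_degree_endo_form: "w \<in> C k \<Longrightarrow> of_degree k (endo_form w)"
  by (auto simp: of_degree_def app_endo_form cochain_0 intro!: endo_eqI)

lemma multilinear_endo_form:
  assumes "w \<in> C k"
  shows "multilinear (endo_form w)"
proof -
  have *: "linear (\<lambda>x. w (xs @ x # ys) u)" for xs ys u
  proof (cases "length (xs @ 0 # ys) = k \<and> length xs < k")
    case True
    then have "linear (\<lambda>x. w ((xs @ 0 # ys)[length xs := x]) u)"
      using assms unfolding cochains_def by blast
    then show ?thesis by simp
  qed (use assms in \<open>simp add: cochain_0 linear_zero\<close>)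
  have "linear (\<lambda>x. endo_form w (xs @ x # ys))" for xs ys
    by (rule linearI; rule endo_eqI)
       (simp_all add: app_endo_form[OF assms] linear_add[OF *] linear_scale[OF *])
  then show ?thesis by (simp add: multilinear_def)
qed

lemma alternating_endo_form:
  assumes "w \<in> C k"
  shows "alternating (endo_form w)"
proof -
  have "w (xs @ x # x # ys) u = 0" for xs x ys u
  proof (cases "length (xs @ x # x # ys) = k")
    case True
    then have "length xs < Suc (length xs) \<and> Suc (length xs) < k \<and>
        (xs @ x # x # ys) ! length xs = (xs @ x # x # ys) ! Suc (length xs)"
      by (auto simp: nth_append)
    with True show ?thesis using assms unfolding cochains_def by blast
  qed (use assms in \<open>simp add: cochain_0\<close>)
  then show ?thesis by (auto simp: alternating_def app_endo_form[OF assms] intro!: endo_eqI)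
qed

lemma off_diagonal_endo_form: "w \<in> C k \<Longrightarrow> off_diagonal (endo_form w)"
  by (auto simp: off_diagonal_def fun_eq_iff app_endo_form intro!: endo_eqI)

lemma cochain_of_in_cochains:
  assumes "of_degree k F" "multilinear F" "alternating F"
  shows "cochain_of F \<in> C k"
  unfolding cochains_def
proof (intro CollectI conjI allI ballI impI)
  fix xs u
  show "cochain_of F xs u = 0" if "length xs \<noteq> k \<or> u \<notin> I"
    using that assms(1) by (auto simp: cochain_of_def of_degree_def)
  fix i assume "length xs = k \<and> i < k"
  then show "linear (\<lambda>x. cochain_of F (xs[i := x]) u)"
    using linear_add[OF multilinearD[OF assms(2)]] linear_scale[OF multilinearD[OF assms(2)]]
    by (auto simp: upd_conv_take_nth_drop cochain_of_def intro!: linearI)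
next
  fix xs :: "'g list" and i j u assume ij: "length xs = k \<and> i < j \<and> j < k \<and> xs ! i = xs ! j"
  have "xs = take j xs @ xs ! j # drop (Suc j) xs" using ij by (intro id_take_nth_drop) auto
  also have "take j xs = take i (take j xs) @ take j xs ! i # drop (Suc i) (take j xs)"
    using ij by (intro id_take_nth_drop) auto
  finally have "F xs = F (take i xs @ xs ! i # drop (Suc i) (take j xs) @ xs ! i # drop (Suc j) xs)"
    using ij by (simp add: min_def)
  then have "F xs = 0" by (simp add: alternating_repeated[OF assms(2,3)])
  then show "cochain_of F xs u = 0" by (simp add: cochain_of_def)
next
  fix xs u v a b assume "u \<in> I" "v \<in> I"
  then show "cochain_of F xs (a *\<^sub>R u + b *\<^sub>R v) = a *\<^sub>R cochain_of F xs u + b *\<^sub>R cochain_of F xs v"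
    using linear_app[of "F xs"]
    by (simp add: cochain_of_def I_iff linear_add linear_scale)
qed

lemma endo_form_cochain_of:
  assumes "of_degree k F" "multilinear F" "alternating F" "off_diagonal F"
  shows "endo_form (cochain_of F) = F"
proof (rule ext, rule endo_eqI)
  fix xs v
  have "F xs = to_complement * (F xs * to_ideal)"
    using assms(4) by (metis off_diagonal_def)
  then have "app (F xs) v = app (to_complement * (F xs * to_ideal)) v" by simp
  then show "app (endo_form (cochain_of F) xs) v = app (F xs) v"
    by (simp add: app_endo_form[OF cochain_of_in_cochains[OF assms(1-3)]] cochain_of_def)
qed

lemma cochain_of_lincomb: "cochain_of (c *\<^sub>R F + G) = c *\<^sub>R cochain_of F + cochain_of G"
  by (auto simp: fun_eq_iff cochain_of_def)

lemma cochain_of_0 [simp]: "cochain_of 0 = 0"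
  by (simp add: fun_eq_iff cochain_of_def)

text \<open>
  The projections onto both summands commute with \<open>split_action\<close>, so the differential acts within
  blocks.
\<close>

lemma off_diagonal_ce:
  assumes "off_diagonal F"
  shows "off_diagonal (ce F)"
proof -
  have commute: "to_complement * split_action x = split_action x * to_complement" "to_ideal * split_action x = split_action x * to_ideal" for x
    by (auto intro!: endo_eqI simp: pr_id pi_br)
  have F: "(\<lambda>xs. to_complement * F xs) = F" "(\<lambda>xs. F xs * to_ideal) = F" using assms by (simp_all add: off_diagonal_def)
  have "to_complement * ce F xs = ce F xs" for xs
    using ce_mult_left[of to_complement F, OF commute(1)] unfolding F by (rule sym)
  moreover have "ce F xs * to_ideal = ce F xs" for xs
    using ce_mult_right[of to_ideal F, OF commute(2)] unfolding F by (rule sym)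
  ultimately show ?thesis by (simp add: off_diagonal_def)
qed

lemma off_diagonal_brace:
  assumes "off_diagonal F" "off_diagonal G"
  shows "off_diagonal (brace F G)"
proof -
  have F: "(\<lambda>xs. F xs * to_ideal) = F" and G: "(\<lambda>xs. to_complement * G xs) = G"
    using assms by (simp_all add: off_diagonal_def)
  have "to_complement * brace F G xs = brace F G xs" for xs
    using wedge_mult_left[of "wedge F beta" to_complement G] unfolding G brace_def by (rule sym)
  moreover have "(\<lambda>xs. wedge F beta xs * to_ideal) = wedge F beta"
    using wedge_mult_right[of F to_ideal beta] unfolding F by (intro ext) (rule sym)
  then have "brace F G xs * to_ideal = brace F G xs" for xs
    using wedge_mult_right[of "wedge F beta" to_ideal G] unfolding brace_def by metis
  ultimately show ?thesis by (simp add: off_diagonal_def)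
qed

lemma off_diagonal_lincomb:
  "off_diagonal F \<Longrightarrow> off_diagonal (c *\<^sub>R F)"
  "off_diagonal F \<Longrightarrow> off_diagonal G \<Longrightarrow> off_diagonal (F - G)"
  "off_diagonal F \<Longrightarrow> off_diagonal (- F)"
  by (auto simp: off_diagonal_def fun_eq_iff algebra_simps)

end

context split_ideal
begin

text \<open>
  On the corner block from \<open>I\<close> to the complement, the commutator with \<open>split_action x\<close> is \<open>ad_Hom\<close>.
\<close>

lemma delta_Hom_eq:
  assumes "w \<in> C k"
  shows "delta_Hom br I \<pi> k w = cochain_of (ce (endo_form w))"
proof (intro ext)
  fix xs u
  show "delta_Hom br I \<pi> k w xs u = cochain_of (ce (endo_form w)) xs u"
  proof (cases "length xs = k + 1 \<and> u \<in> I")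
    case True
    then have u: "\<pi> u = 0" by (simp add: I_iff)
    \<comment> \<open>On \<open>I\<close> the action of \<open>x\<close> is \<open>br x\<close>; on the range of \<open>\<sigma>\<close> it is the bracket of the quotient.\<close>
    have D: "\<pi> (app (split_action x * endo_form w zs - endo_form w zs * split_action x) u) = ad_Hom br I \<pi> x (w zs) u" for x zs
      using True quot_bracket[OF lie ideal quotient, of x "\<sigma> (w zs u)"]
      by (simp add: ad_Hom_def app_endo_form[OF assms] pr_id pi_br u)
    have W: "\<pi> (app (endo_form w zs) u) = w zs u" for zs
      by (simp add: app_endo_form[OF assms] pr_id u)
    show ?thesis
      using True
      by (simp add: delta_Hom_def cochain_of_def ce_explicit[OF multilinear_endo_form[OF assms] alternating_endo_form[OF assms]]
          app_sum linear_sum[OF linear_pi] W D[unfolded app_simps] flip: D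
          del: app_simps(3) app_simps(5))
  next
    case False
    then show ?thesis
      using of_degree_ce[OF of_degree_endo_form[OF assms]] cochain_0[OF assms]
      by (auto simp: delta_Hom_def cochain_of_def of_degree_def ad_Hom_def)
  qed
qed

lemma shuffle_insert_eq:
  assumes "\<psi> \<in> C k" "\<phi> \<in> C l" "length xs = k + l + 1" "u \<in> I"
  shows "shuffle_insert br \<pi> \<sigma> k l \<psi> \<phi> xs u = \<pi> (app (brace (endo_form \<psi>) (endo_form \<phi>) xs) u)"
proof -
  have u: "prI u = u" using assms(4) by (simp add: pr_id I_iff)
  have "take (Suc 0) (drop k (perm_list \<tau> xs)) = [perm_list \<tau> xs ! k]" for \<tau>
    using assms(3) by (simp add: take_Suc_conv_app_nth perm_list_def del: upt_Suc)
  then have "brace (endo_form \<psi>) (endo_form \<phi>) xs = (\<Sum>\<tau>\<in>block_perms [k, 1, l]. of_int (sign \<tau>) *\<^sub>R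
      (let ys = perm_list \<tau> xs in endo_form \<phi> (drop (k + 1) ys) * beta [ys ! k] * endo_form \<psi> (take k ys)))"
    using sum_block_perms_eq_wedge[OF of_degree_endo_form[OF assms(1)] degree_beta of_degree_endo_form[OF assms(2)], of xs] assms(3)
    by (simp add: brace_def Let_def)
  then show ?thesis
    by (simp add: shuffle_insert_def app_sum linear_sum[OF linear_pi] Let_def app_endo_form[OF assms(1)] app_endo_form[OF assms(2)] u)
qed

lemma m2_eq:
  assumes "\<psi> \<in> C k" "\<phi> \<in> C l"
  shows "m2 br I \<pi> \<sigma> k l \<psi> \<phi> = cochain_of (bracket k l (endo_form \<psi>) (endo_form \<phi>))"
proof (intro ext)
  fix xs u
  show "m2 br I \<pi> \<sigma> k l \<psi> \<phi> xs u = cochain_of (bracket k l (endo_form \<psi>) (endo_form \<phi>)) xs u"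
  proof (cases "length xs = k + l + 1 \<and> u \<in> I")
    case True
    then show ?thesis
      using shuffle_insert_eq[OF assms, of xs u] shuffle_insert_eq[OF assms(2,1), of xs u]
      by (simp add: m2_def cochain_of_def bracket_def)
  next
    case False
    then show ?thesis
      using of_degree_bracket[OF of_degree_endo_form[OF assms(1)] of_degree_endo_form[OF assms(2)]]
      by (auto simp: m2_def cochain_of_def of_degree_def)
  qed
qed

definition cochain_form :: "nat \<Rightarrow> ('g list \<Rightarrow> 'g endo) \<Rightarrow> bool" where
  "cochain_form k F \<longleftrightarrow> of_degree k F \<and> multilinear F \<and> alternating F \<and> off_diagonal F"

lemma cochain_form_endo_form: "w \<in> C k \<Longrightarrow> cochain_form k (endo_form w)"
  by (simp add: cochain_form_def of_degree_endo_form multilinear_endo_form alternating_endo_form off_diagonal_endo_form)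

lemma cochain_form_cochain_of: "cochain_form k F \<Longrightarrow> cochain_of F \<in> C k"
  by (simp add: cochain_form_def cochain_of_in_cochains)

lemma cochain_form_endo_form_cochain_of: "cochain_form k F \<Longrightarrow> endo_form (cochain_of F) = F"
  unfolding cochain_form_def using endo_form_cochain_of by blast

lemma cochain_form_ce: "cochain_form k F \<Longrightarrow> cochain_form (Suc k) (ce F)"
  by (simp add: cochain_form_def of_degree_ce multilinear_ce alternating_ce off_diagonal_ce)

lemma multilinear_beta: "multilinear beta" and alternating_beta: "alternating beta"
proof -
  have "linear (\<lambda>x. beta (xs @ x # ys))" for xs ys
  proof (cases "xs = [] \<and> ys = []")
    case True
    then show ?thesis
      by (auto intro!: linearI endo_eqI)
  next
    case False
    then have "beta (xs @ x # ys) = 0" for x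
      by (cases xs; cases "tl xs"; cases ys) auto
    then show ?thesis by (simp add: linear_zero)
  qed
  then show "multilinear beta" by (simp add: multilinear_def)
  have "beta (xs @ x # x # ys) = 0" for xs x ys
    by (cases xs; cases "tl xs") auto
  then show "alternating beta" by (simp add: alternating_def)
qed

lemma cochain_form_brace: "cochain_form k F \<Longrightarrow> cochain_form l G \<Longrightarrow> cochain_form (Suc (k + l)) (brace F G)"
  using of_degree_brace[of k F l G]
  by (simp add: cochain_form_def off_diagonal_brace) (simp add: brace_def multilinear_wedge alternating_wedge multilinear_beta alternating_beta)

lemma cochain_form_bracket: "cochain_form k F \<Longrightarrow> cochain_form l G \<Longrightarrow> cochain_form (Suc (k + l)) (bracket k l F G)"
  using cochain_form_brace[of k F l G] cochain_form_brace[of l G k F]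
  by (simp add: cochain_form_def bracket_def off_diagonal_lincomb add.commute)

abbreviation "m \<equiv> ideal_brackets br I \<pi> \<sigma>"

text \<open>
  All brackets are now operations on forms. Together with \<open>cochain_form_endo_form_cochain_of\<close> this
  reduces nested brackets of cochains to nested operations on forms.
\<close>

lemma m_1: "w \<in> C k \<Longrightarrow> m [(k, w)] = cochain_of (ce (endo_form w))"
  by (simp add: delta_Hom_eq)

lemma m_2: "v \<in> C k \<Longrightarrow> w \<in> C l \<Longrightarrow> m [(k, v), (l, w)] = cochain_of (bracket k l (endo_form v) (endo_form w))"
  by (simp add: m2_eq)

lemma m_ge_3: "2 < length xs \<Longrightarrow> m xs = 0"
  by (cases xs; cases "tl xs"; cases "tl (tl xs)") auto

end

section \<open>Permutations and signs for at most three arguments\<close>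

lemma insert_perm_0_id [simp]: "insert_perm 0 id = id"
  by (auto simp: insert_perm_def fun_eq_iff)

lemma sum_block_perms_n_0: "sum f (block_perms [n, 0]) = f id"
proof -
  have "sum f (block_perms [n, 0, 0]) = f id"
    by (induction n arbitrary: f) (simp_all add: block_perms_0 sum_block_perms)
  then show ?thesis by (simp only: block_perms_2)
qed

lemma sum_block_perms_1_1: "sum f (block_perms [1, 1]) = f id + f (insert_perm 1 id)"
  by (simp add: block_perms_2 sum_block_perms block_perms_0)

lemma sum_block_perms_2_1:
  "sum f (block_perms [2, 1]) = f id + f (insert_perm 0 (insert_perm 1 id)) + f (insert_perm 2 id)"
  by (simp add: block_perms_2 sum_block_perms block_perms_0 numeral_2_eq_2 add.assoc)

text \<open>
  On blocks of length one the monotonicity condition is empty.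
\<close>

lemma permutes_lessThan_2: "\<tau> permutes {..<2} \<Longrightarrow> \<tau> = id \<or> \<tau> = insert_perm 1 id"
proof -
  assume "\<tau> permutes {..<2}"
  then have "\<tau> \<in> block_perms [1, 1, 0]" by (auto simp: block_perms_3 in_block_def numeral_2_eq_2)
  then show ?thesis by (auto simp: block_perms_decompose block_perms_0)
qed

lemma perm_list_id [simp]: "perm_list id xs = xs"
  by (simp add: perm_list_def map_nth)

lemma perm_list_small:
  "perm_list (insert_perm 1 id) [x, y] = [y, x]"
  "perm_list (insert_perm 0 (insert_perm 1 id)) [x, y, z] = [x, z, y]"
  "perm_list (insert_perm 2 id) [x, y, z] = [y, z, x]"
  by (simp_all add: perm_list_def insert_perm_def upt_rec)

lemma koszul_sign_id [simp]: "koszul_sign id ds = 1"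
proof -
  have "{(i, j). i < j \<and> j < length ds \<and> id j < id i} = {}" by auto
  then show ?thesis by (simp only: koszul_sign_def) simp
qed

lemma koszul_sign_small:
  "koszul_sign (insert_perm 1 id) [k, l] = (-1) ^ (k * l)"
  "koszul_sign (insert_perm 0 (insert_perm 1 id)) [k, l, n] = (-1) ^ (l * n)"
  "koszul_sign (insert_perm 2 id) [k, l, n] = (-1) ^ (k * l + k * n)"
proof -
  have "{(i, j). i < j \<and> j < length [k, l] \<and> insert_perm 1 id j < insert_perm 1 id i} = {(0, 1)}"
    by (auto simp: insert_perm_def less_Suc_eq split: if_splits)
  then show "koszul_sign (insert_perm 1 id) [k, l] = (-1) ^ (k * l)"
    by (simp only: koszul_sign_def) (simp add: insert_perm_def mult.commute)
  have "{(i, j). i < j \<and> j < length [k, l, n] \<and>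
      insert_perm 0 (insert_perm 1 id) j < insert_perm 0 (insert_perm 1 id) i} = {(1, 2)}"
    by (auto simp: insert_perm_def less_Suc_eq split: if_splits)
  then show "koszul_sign (insert_perm 0 (insert_perm 1 id)) [k, l, n] = (-1) ^ (l * n)"
    by (simp only: koszul_sign_def) (simp add: insert_perm_def mult.commute)
  have "{(i, j). i < j \<and> j < length [k, l, n] \<and> insert_perm 2 id j < insert_perm 2 id i} = {(0, 2), (1, 2)}"
    by (auto simp: insert_perm_def less_Suc_eq split: if_splits)
  then show "koszul_sign (insert_perm 2 id) [k, l, n] = (-1) ^ (k * l + k * n)"
    by (simp only: koszul_sign_def) (simp add: insert_perm_def mult.commute power_add)
qed

lemma homogeneous_perm_list:
  assumes "homogeneous V xs" "\<tau> permutes {..<length xs}"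
  shows "homogeneous V (perm_list \<tau> xs)"
  using assms permutes_in_image[OF assms(2)] by (fastforce simp: homogeneous_def perm_list_def)

section \<open>Maurer--Cartan elements and graphs\<close>

lemma dim_inj_image:
  assumes "linear g" "inj g"
  shows "dim (g ` S) = dim S"
proof -
  obtain B where B: "B \<subseteq> S" "independent B" "S \<subseteq> span B" "card B = dim S"
    using basis_exists[of S] by blast
  have "span (g ` B) = span (g ` S)"
    using B span_mono[OF B(1)] span_mono[OF B(3)]
    by (metis linear_span_image[OF assms(1)] span_span subset_antisym)
  moreover have "independent (g ` B)"
    using linear_independent_injective_image[OF assms(1) B(2)] assms(2) by (simp add: inj_on_def)
  ultimately have "dim (g ` S) = card (g ` B)" by (rule dim_eq_card)
  also have "\<dots> = card B" using assms(2) by (intro card_image) (simp add: inj_on_def)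
  finally show ?thesis using B(4) by simp
qed

context split_ideal
begin

definition graph :: "('g list \<Rightarrow> 'g \<Rightarrow> 'q) \<Rightarrow> 'g set" where
  "graph \<phi> = {u + \<sigma> (\<phi> [] u) | u. u \<in> I}"

lemma graph_iff: "v \<in> graph \<phi> \<longleftrightarrow> \<pi> v = \<phi> [] (prI v)"
proof
  assume "v \<in> graph \<phi>"
  then show "\<pi> v = \<phi> [] (prI v)" by (auto simp: graph_def I_iff pr_id)
next
  assume "\<pi> v = \<phi> [] (prI v)"
  then have "v = prI v + \<sigma> (\<phi> [] (prI v))" by (simp add: pr_def)
  then show "v \<in> graph \<phi>" unfolding graph_def using pr_in_I by blast
qed

lemma brackets_MC:
  assumes "\<phi> \<in> C 0" "u \<in> I"
  shows "(m [(0, \<phi>)] + (1 / 2) *\<^sub>R m [(0, \<phi>), (0, \<phi>)]) [x] u =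
    \<pi> (br x (\<sigma> (\<phi> [] u))) - \<phi> [] (br x u + prI (br x (\<sigma> (\<phi> [] u))))"
proof -
  have vanish: "endo_form \<phi> [y] = 0" for y
    using of_degree_endo_form[OF assms(1)] by (simp add: of_degree_def)
  have u: "\<pi> u = 0" "prI u = u" using assms(2) by (simp_all add: I_iff pr_id)
  have "br x u \<in> I" using u by (simp add: I_iff pi_br)
  note lin = cochain_lin(1)[OF assms(1) this pr_in_I]
  have "ce (endo_form \<phi>) [x] = split_action x * endo_form \<phi> [] - endo_form \<phi> [] * split_action x"
    by simp
  moreover have "bracket 0 0 (endo_form \<phi>) (endo_form \<phi>) [x] = - 2 *\<^sub>R (endo_form \<phi> [] * (beta [x] * endo_form \<phi> []))"
    by (simp add: bracket_def brace_def contract_def parity_def vanish scaleR_2)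
  ultimately show ?thesis
    unfolding m_1[OF assms(1)] m_2[OF assms(1) assms(1)]
    using assms(2) u lin
    by (simp add: cochain_of_def app_endo_form[OF assms(1)] pr_id pi_br)
qed

lemma MC_iff:
  assumes "\<phi> \<in> C 0"
  shows "\<phi> \<in> MC_elements C m \<longleftrightarrow>
    (\<forall>x. \<forall>u\<in>I. \<pi> (br x (\<sigma> (\<phi> [] u))) = \<phi> [] (br x u + prI (br x (\<sigma> (\<phi> [] u)))))"
proof -
  define w where "w = m [(0, \<phi>)] + (1 / 2) *\<^sub>R m [(0, \<phi>), (0, \<phi>)]"
  have "w \<in> C 1"
    unfolding w_def m_1[OF assms] m_2[OF assms assms]
    using cochain_form_cochain_of[OF cochain_form_ce[OF cochain_form_endo_form[OF assms]]]
      cochain_form_cochain_of[OF cochain_form_bracket[OF cochain_form_endo_form[OF assms] cochain_form_endo_form[OF assms]]]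
    by (intro subspace_add subspace_scale subspace_cochains) simp_all
  have "w xs u = 0" if "\<forall>x. \<forall>u\<in>I. w [x] u = 0" for xs u
  proof (cases "length xs = 1 \<and> u \<in> I")
    case True
    then show ?thesis using that by (auto simp: length_Suc_conv)
  qed (use cochain_0[OF \<open>w \<in> C 1\<close>] in auto)
  then have "w = 0 \<longleftrightarrow> (\<forall>x. \<forall>u\<in>I. w [x] u = 0)"
    by (auto simp: fun_eq_iff)
  then show ?thesis
    using assms brackets_MC[OF assms, folded w_def] by (simp add: MC_elements_def del: ideal_brackets.simps flip: w_def)
qed

text \<open>
  The shear \<open>v \<mapsto> v + \<sigma> (\<phi> (pr v))\<close> is an injective linear map that sends \<open>I\<close> onto the graph.
\<close>

lemma graph_complement:
  assumes "\<phi> \<in> C 0"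
  shows "subspace (graph \<phi>)" "dim (graph \<phi>) = dim I" "graph \<phi> \<inter> range \<sigma> = {0}"
    "\<exists>v\<in>graph \<phi>. \<exists>w\<in>range \<sigma>. x = v + w"
proof -
  have lin: "linear (\<lambda>v. \<phi> [] (prI v))"
    by (rule linearI) (simp_all add: cochain_lin(1)[OF assms] cochain_lin(2)[OF assms, where v = 0] I_iff)
  note lin_simps = linear_add[OF lin] linear_scale[OF lin] linear_0[OF lin]
  show "subspace (graph \<phi>)"
    by (rule subspaceI) (use lin_simps in \<open>simp_all add: graph_iff\<close>)
  define g where "g v = v + \<sigma> (\<phi> [] (prI v))" for v
  have "graph \<phi> = g ` I" by (auto simp: graph_def g_def I_iff pr_id)
  moreover have "linear g"
    unfolding g_def by (rule linearI) (use lin_simps in \<open>simp_all add: algebra_simps\<close>)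
  moreover have "inj g"
  proof (rule injI)
    fix v w assume eq: "g v = g w"
    then have "prI (g v) = prI (g w)" by simp
    then have "prI v = prI w" by (simp add: g_def)
    with eq show "v = w" by (simp add: g_def)
  qed
  ultimately show "dim (graph \<phi>) = dim I" by (simp add: dim_inj_image)
  show "graph \<phi> \<inter> range \<sigma> = {0}"
    using lin_simps(3) by (auto simp: graph_iff image_iff intro!: exI[of _ 0])
  have "prI x + \<sigma> (\<phi> [] (prI x)) \<in> graph \<phi>" by (auto simp: graph_def)
  moreover have "x = (prI x + \<sigma> (\<phi> [] (prI x))) + \<sigma> (\<pi> x - \<phi> [] (prI x))"
    by (simp add: pr_def)
  ultimately show "\<exists>v\<in>graph \<phi>. \<exists>w\<in>range \<sigma>. x = v + w" by blast
qed

text \<open>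
  The components of \<open>br x (u + \<sigma> (\<phi> u))\<close> in \<open>I\<close> and in the quotient are the argument of \<open>\<phi>\<close> and the
  left-hand side of the equation in \<open>MC_iff\<close>.
\<close>

lemma MC_iff_small_deformation:
  assumes "\<phi> \<in> C 0"
  shows "\<phi> \<in> MC_elements C m \<longleftrightarrow> small_deformation br I \<sigma> (graph \<phi>)"
proof -
  have ball: "(\<forall>v\<in>graph \<phi>. X v) \<longleftrightarrow> (\<forall>u\<in>I. X (u + \<sigma> (\<phi> [] u)))" for X
    by (auto simp: graph_def)
  have "br x (u + \<sigma> (\<phi> [] u)) \<in> graph \<phi> \<longleftrightarrow>
      \<pi> (br x (\<sigma> (\<phi> [] u))) = \<phi> [] (br x u + prI (br x (\<sigma> (\<phi> [] u))))" if "u \<in> I" for x u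
    using that by (simp add: graph_iff I_iff pi_br pr_id)
  then have "\<phi> \<in> MC_elements C m \<longleftrightarrow> (\<forall>x. \<forall>v\<in>graph \<phi>. br x v \<in> graph \<phi>)"
    unfolding MC_iff[OF assms] ball by simp
  then show ?thesis
    using graph_complement[OF assms] by (simp add: small_deformation_def lie_ideal_def)
qed

lemma inj_graph: "inj_on graph (C 0)"
proof (rule inj_onI, intro ext)
  fix \<phi> \<psi> xs u
  assume C: "\<phi> \<in> C 0" "\<psi> \<in> C 0" and eq: "graph \<phi> = graph \<psi>"
  show "\<phi> xs u = \<psi> xs u"
  proof (cases "xs = [] \<and> u \<in> I")
    case True
    then have "u + \<sigma> (\<phi> [] u) \<in> graph \<psi>" using eq by (auto simp: graph_def)
    with True show ?thesis by (simp add: graph_iff I_iff pr_id)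
  qed (use cochain_0[OF C(1)] cochain_0[OF C(2)] in auto)
qed

text \<open>
  For each \<open>u\<close> a complement \<open>J\<close> contains exactly one element of the form \<open>u + \<sigma> q\<close>; uniqueness makes
  \<open>q\<close> depend linearly on \<open>u\<close>.
\<close>

lemma small_deformation_graph:
  assumes "small_deformation br I \<sigma> J"
  obtains \<phi> where "\<phi> \<in> C 0" "J = graph \<phi>"
proof -
  have sub: "subspace J" and int: "J \<inter> range \<sigma> = {0}" and sum: "\<And>x. \<exists>v\<in>J. \<exists>w\<in>range \<sigma>. x = v + w"
    using assms by (auto simp: small_deformation_def)
  have uniq: "q = q'" if "u + \<sigma> q \<in> J" "u + \<sigma> q' \<in> J" for u q q'
  proof -
    have "\<sigma> (q - q') \<in> J" using subspace_diff[OF sub that] by simp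
    then have "\<sigma> (q - q') = 0" using int by blast
    then have "\<pi> (\<sigma> (q - q')) = 0" by (simp only: linear_simps)
    then show ?thesis by simp
  qed
  define f where "f u = (THE q. u + \<sigma> q \<in> J)" for u
  have "\<exists>q. u + \<sigma> q \<in> J" for u
  proof -
    obtain v q where "v \<in> J" "u = v + \<sigma> q" using sum[of u] by blast
    then have "u + \<sigma> (- q) \<in> J" by simp
    then show ?thesis by blast
  qed
  then have f: "u + \<sigma> q \<in> J \<longleftrightarrow> f u = q" for u q
    unfolding f_def using uniq by (metis the_equality)
  have f_in: "u + \<sigma> (f u) \<in> J" for u by (simp add: f)
  have f_lin: "f (a *\<^sub>R u + b *\<^sub>R v) = a *\<^sub>R f u + b *\<^sub>R f v" for a b u v
  proof -
    have "a *\<^sub>R (u + \<sigma> (f u)) + b *\<^sub>R (v + \<sigma> (f v)) \<in> J"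
      by (intro subspace_add[OF sub] subspace_scale[OF sub] f_in)
    then have "(a *\<^sub>R u + b *\<^sub>R v) + \<sigma> (a *\<^sub>R f u + b *\<^sub>R f v) \<in> J" by (simp add: algebra_simps)
    then show ?thesis by (simp only: f)
  qed
  define \<phi> where "\<phi> xs u = (if xs = [] \<and> u \<in> I then f u else 0)" for xs :: "'g list" and u
  have "\<phi> \<in> C 0"
    by (auto simp: cochains_def \<phi>_def f_lin I_iff)
  moreover have "v \<in> J \<longleftrightarrow> v \<in> graph \<phi>" for v
  proof -
    have "prI v + \<sigma> (\<pi> v) = v" by (simp add: pr_def)
    then show ?thesis using f[of "prI v" "\<pi> v"] by (auto simp: graph_iff \<phi>_def)
  qed
  ultimately show ?thesis using that[of \<phi>] by blast
qed

lemma bij_betw_graph: "bij_betw graph (MC_elements C m) {J. small_deformation br I \<sigma> J}"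
  unfolding bij_betw_def
proof (intro conjI subset_antisym subsetI)
  have sub: "MC_elements C m \<subseteq> C 0" by (auto simp: MC_elements_def)
  show "inj_on graph (MC_elements C m)" using inj_graph sub by (rule inj_on_subset)
  show "J \<in> {J. small_deformation br I \<sigma> J}" if "J \<in> graph ` MC_elements C m" for J
    using that sub MC_iff_small_deformation by blast
  show "J \<in> graph ` MC_elements C m" if "J \<in> {J. small_deformation br I \<sigma> J}" for J
    using that MC_iff_small_deformation small_deformation_graph by blast
qed

section \<open>The higher Jacobi identities\<close>

lemma cochain_of_add: "cochain_of (F + G) = cochain_of F + cochain_of G"
  and cochain_of_scaleR: "cochain_of (c *\<^sub>R F) = c *\<^sub>R cochain_of F"
  using cochain_of_lincomb[of 1 F G] cochain_of_lincomb[of c F 0] by simp_all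

lemma m_0:
  assumes "homogeneous C ys"
  shows "m ((d, 0) # ys) = 0"
proof -
  have 0: "0 \<in> C k" for k by (rule subspace_0[OF subspace_cochains])
  consider "ys = []" | l w where "ys = [(l, w)]" "w \<in> C l" | "2 < length ((d, 0 :: 'g list \<Rightarrow> 'g \<Rightarrow> 'q) # ys)"
    using assms by (cases ys; cases "tl ys") (auto simp: homogeneous_def)
  then show ?thesis
    by cases (simp_all add: 0 m_1 m_2 m_ge_3 bracket_def del: ideal_brackets.simps)
qed

lemma homogeneous_cases [consumes 2, case_names 1 2 3]:
  assumes "xs \<noteq> []" "homogeneous C xs"
  obtains k w where "xs = [(k, w)]" "w \<in> C k"
  | k v l w where "xs = [(k, v), (l, w)]" "v \<in> C k" "w \<in> C l"
  | "2 < length xs"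
  using assms by (cases xs; cases "tl xs"; cases "tl (tl xs)") (auto simp: homogeneous_def)

lemma Linfty1_ideal_brackets: "Linfty1_algebra C m"
  unfolding Linfty1_algebra_def
proof (intro conjI allI impI)
  fix d show "subspace (C d)" by (rule subspace_cochains)
next
  fix xs :: "(nat \<times> ('g list \<Rightarrow> 'g \<Rightarrow> 'q)) list"
  assume xs: "xs \<noteq> [] \<and> homogeneous C xs"
  show "m xs \<in> C (Suc (total_degree xs))"
    using xs[THEN conjunct1] xs[THEN conjunct2]
  proof (cases rule: homogeneous_cases)
    case 1
    then show ?thesis
      unfolding 1 m_1[OF 1(2)] using cochain_form_cochain_of[OF cochain_form_ce[OF cochain_form_endo_form[OF 1(2)]]]
      by (simp add: total_degree_def)
  next
    case 2
    then show ?thesis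
      unfolding 2 m_2[OF 2(2,3)] using cochain_form_cochain_of[OF cochain_form_bracket[OF cochain_form_endo_form[OF 2(2)] cochain_form_endo_form[OF 2(3)]]]
      by (simp add: total_degree_def)
  next
    case 3
    then show ?thesis by (simp add: m_ge_3 subspace_0[OF subspace_cochains])
  qed
next
  fix xs i d a b c
  assume "homogeneous C xs \<and> i < length xs \<and> d = fst (xs ! i) \<and> a \<in> C d \<and> b \<in> C d"
  then have xs: "homogeneous C xs" and i: "i < length xs" and d: "d = fst (xs ! i)" and ab: "a \<in> C d" "b \<in> C d"
    by auto
  have cab: "c *\<^sub>R a + b \<in> C d"
    using ab by (intro subspace_add subspace_scale subspace_cochains)
  have br_lin: "bracket k l (r *\<^sub>R F + G) H = r *\<^sub>R bracket k l F H + bracket k l G H"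
    "bracket k l H (r *\<^sub>R F + G) = r *\<^sub>R bracket k l H F + bracket k l H G" for k l r F G H
    by (simp_all add: bracket_def algebra_simps)
  have "xs \<noteq> []" using i by auto
  then show "m (xs[i := (d, c *\<^sub>R a + b)]) = c *\<^sub>R m (xs[i := (d, a)]) + m (xs[i := (d, b)])"
    using xs
  proof (cases rule: homogeneous_cases)
    case 1
    with i have i: "i = 0" by simp
    show ?thesis
      using ab cab 1
      by (simp add: i m_1 endo_form_lincomb cochain_of_lincomb del: ideal_brackets.simps)
  next
    case 2
    with i consider "i = 0" | "i = 1" by force
    then show ?thesis
    proof cases
      case i: 1
      show ?thesis
        using ab cab 2
        by (simp add: i m_2 endo_form_lincomb cochain_of_lincomb br_lin del: ideal_brackets.simps)
    next
      case i: 2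
      show ?thesis
        using ab cab 2
        by (simp add: i m_2 endo_form_lincomb cochain_of_lincomb br_lin del: ideal_brackets.simps)
    qed
  qed (simp add: m_ge_3)
next
  fix xs :: "(nat \<times> ('g list \<Rightarrow> 'g \<Rightarrow> 'q)) list" and \<tau>
  assume "xs \<noteq> [] \<and> homogeneous C xs \<and> \<tau> permutes {..<length xs}"
  then have xs: "xs \<noteq> []" "homogeneous C xs" and \<tau>: "\<tau> permutes {..<length xs}" by auto
  show "m xs = koszul_sign \<tau> (map fst xs) *\<^sub>R m (perm_list \<tau> xs)"
    using xs
  proof (cases rule: homogeneous_cases)
    case 1
    with \<tau> have "\<tau> = id" by (simp add: lessThan_Suc)
    then show ?thesis by simp
  next
    case (2 k v l w)
    with \<tau> permutes_lessThan_2 have "\<tau> = id \<or> \<tau> = insert_perm 1 id" by (simp add: numeral_2_eq_2)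
    then show ?thesis
    proof
      assume "\<tau> = insert_perm 1 id"
      then show ?thesis
        using bracket_symmetric[of k l "endo_form v" "endo_form w"] 2 cochain_of_lincomb[of "(-1) ^ (k * l)" _ 0]
        by (simp add: perm_list_small[unfolded One_nat_def] koszul_sign_small[unfolded One_nat_def] m_2
            del: ideal_brackets.simps)
    qed simp
  next
    case 3
    then show ?thesis by (simp add: m_ge_3 perm_list_def)
  qed
next
  fix xs :: "(nat \<times> ('g list \<Rightarrow> 'g \<Rightarrow> 'q)) list"
  assume xs: "xs \<noteq> [] \<and> homogeneous C xs"
  let ?t = "\<lambda>i \<tau>. koszul_sign \<tau> (map fst xs) *\<^sub>R
           (let ys = perm_list \<tau> xs; inner = take i ys
            in m ((Suc (total_degree inner), m inner) # drop i ys))"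
  \<comment> \<open>With more than two arguments inside or outside, one of the two nested brackets vanishes.\<close>
  have trivial: "sum (?t i) (block_perms [i, length xs - i]) = 0"
    if "1 \<le> i" "i \<le> length xs" "2 < i \<or> i + 2 \<le> length xs" for i
  proof (rule sum.neutral, rule ballI)
    fix \<tau> assume "\<tau> \<in> block_perms [i, length xs - i]"
    then have "\<tau> permutes {..<length xs}" using that(2) by (simp add: block_perms_def)
    then have hom: "homogeneous C (drop i (perm_list \<tau> xs))"
      using homogeneous_perm_list[of C xs \<tau>] xs by (auto simp: homogeneous_def dest: in_set_dropD)
    have len: "length (perm_list \<tau> xs) = length xs" by (simp add: perm_list_def)
    show "?t i \<tau> = 0"
    proof (cases "2 < i")
      case True
      then have "m (take i (perm_list \<tau> xs)) = 0" using that(2) len by (intro m_ge_3) simp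
      then show ?thesis using m_0[OF hom] by (simp add: Let_def)
    next
      case False
      then show ?thesis using that(3) len by (simp add: Let_def m_ge_3)
    qed
  qed
  show "(\<Sum>i=1..length xs. sum (?t i) (block_perms [i, length xs - i])) = 0"
    using xs[THEN conjunct1] xs[THEN conjunct2]
  proof (cases rule: homogeneous_cases)
    case (1 k w)
    have "m [(Suc k, m [(k, w)])] = 0"
      using cochain_form_cochain_of[OF cochain_form_ce[OF cochain_form_endo_form[OF 1(2)]]]
      by (simp add: m_1 1 cochain_form_endo_form_cochain_of[OF cochain_form_ce[OF cochain_form_endo_form[OF 1(2)]]] ce_ce multilinear_endo_form[OF 1(2)]
          del: ideal_brackets.simps)
    then show ?thesis
      by (simp add: 1 sum_block_perms_n_0 total_degree_def del: ideal_brackets.simps)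
  next
    case (2 k v l w)
    note forms = cochain_form_ce[OF cochain_form_endo_form[OF 2(2)]] cochain_form_ce[OF cochain_form_endo_form[OF 2(3)]]
      cochain_form_bracket[OF cochain_form_endo_form[OF 2(2)] cochain_form_endo_form[OF 2(3)]]
    have "m [(Suc k, m [(k, v)]), (l, w)] + (-1) ^ (k * l) *\<^sub>R m [(Suc l, m [(l, w)]), (k, v)]
        + m [(Suc (k + l), m [(k, v), (l, w)])] =
      cochain_of (ce (bracket k l (endo_form v) (endo_form w)) + bracket (Suc k) l (ce (endo_form v)) (endo_form w)
        + (-1) ^ (k * l) *\<^sub>R bracket (Suc l) k (ce (endo_form w)) (endo_form v))"
      by (simp add: m_1 m_2 2 forms[THEN cochain_form_cochain_of] forms[THEN cochain_form_endo_form_cochain_of] cochain_of_add cochain_of_scaleR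
          del: ideal_brackets.simps)
    also have "\<dots> = 0"
      by (subst jacobi_2) (simp_all add: of_degree_endo_form 2)
    finally have "sum (?t 1) (block_perms [1, 1]) + sum (?t 2) (block_perms [2, 0]) = 0"
      unfolding sum_block_perms_1_1 sum_block_perms_n_0
      by (simp add: 2 perm_list_small[unfolded One_nat_def] koszul_sign_small[unfolded One_nat_def]
          total_degree_def del: ideal_brackets.simps)
    moreover have "{1..length xs} = {1, 2}" "length xs - 1 = 1" "length xs - 2 = 0"
      by (auto simp: 2)
    ultimately show ?thesis by simp
  next
    case 3
    show ?thesis
    proof (cases "length xs = 3")
      case True
      then obtain k u l v n w where uvw: "xs = [(k, u), (l, v), (n, w)]" "u \<in> C k" "v \<in> C l" "w \<in> C n"
        using xs by (auto simp: homogeneous_def numeral_3_eq_3 length_Suc_conv)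
      note hats = uvw(2-4)[THEN cochain_form_endo_form]
      note forms = cochain_form_bracket[OF hats(1,2)] cochain_form_bracket[OF hats(1,3)] cochain_form_bracket[OF hats(2,3)]
      have "m [(Suc (k + l), m [(k, u), (l, v)]), (n, w)]
          + (-1) ^ (l * n) *\<^sub>R m [(Suc (k + n), m [(k, u), (n, w)]), (l, v)]
          + (-1) ^ (k * l + k * n) *\<^sub>R m [(Suc (l + n), m [(l, v), (n, w)]), (k, u)] =
        cochain_of (bracket (Suc (k + l)) n (bracket k l (endo_form u) (endo_form v)) (endo_form w)
          + (-1) ^ (l * n) *\<^sub>R bracket (Suc (k + n)) l (bracket k n (endo_form u) (endo_form w)) (endo_form v)
          + (-1) ^ (k * l + k * n) *\<^sub>R bracket (Suc (l + n)) k (bracket l n (endo_form v) (endo_form w)) (endo_form u))"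
        by (simp add: m_2 uvw forms[THEN cochain_form_cochain_of] forms[THEN cochain_form_endo_form_cochain_of] cochain_of_add cochain_of_scaleR
            del: ideal_brackets.simps)
      also have "\<dots> = 0" by (simp add: jacobi_3)
      finally have "sum (?t 2) (block_perms [2, 1]) = 0"
        unfolding sum_block_perms_2_1
        by (simp add: uvw(1) perm_list_small[unfolded One_nat_def] koszul_sign_small[unfolded One_nat_def]
            total_degree_def del: ideal_brackets.simps)
      moreover have "{1..length xs} = {1, 2, 3}" using True by auto
      ultimately show ?thesis using True trivial[of 1] trivial[of 3] by simp
    next
      case False
      then show ?thesis using 3 by (intro sum.neutral ballI trivial) auto
    qed
  qed
qed

end

theorem theorem5p3:
  fixes br :: "'g::real_vector \<Rightarrow> 'g \<Rightarrow> 'g"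
    and I :: "'g set"
    and \<pi> :: "'g \<Rightarrow> 'q::real_vector"
    and \<sigma> :: "'q \<Rightarrow> 'g"
  assumes "\<exists>B :: 'g set. finite B \<and> span B = UNIV"
    and "lie_algebra br"
    and "lie_ideal br I"
    and "quotient_map I \<pi>"
    and "linear \<sigma>"
    and "\<And>q. \<pi> (\<sigma> q) = q"
  shows "Linfty1_algebra (cochains I) (ideal_brackets br I \<pi> \<sigma>) \<and>
         bij_betw (\<lambda>\<phi>. {u + \<sigma> (\<phi> [] u) | u. u \<in> I})
           (MC_elements (cochains I) (ideal_brackets br I \<pi> \<sigma>))
           {J. small_deformation br I \<sigma> J}"
proof -
  interpret split_ideal br I \<pi> \<sigma>
    using assms(2-6) by (intro split_ideal.intro lie_bracket.intro split_ideal_axioms.intro)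
  show ?thesis
    using Linfty1_ideal_brackets bij_betw_graph by (simp add: graph_def[abs_def])
qed

end
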